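(* Let $m\in\mathbb N$, let $\Omega_1,\ldots,\Omega_m$ be metrizable compact Hausdorff spaces, and write $\Omega:=\Omega_1\times\cdots\times\Omega_m$. Let $(\Sigma,\mathscr H,\rho)$ be a measure space, and for all $i=1,\ldots,m$, let $\varphi_i:\Omega_i\times\Sigma\to\mathbb C$ be a product-measurable function such that $\varphi_i(\cdot,\sigma)\in C(\Omega_i)$ whenever $\sigma\in\Sigma$. If $$\int_\Sigma\prod_{i=1}^m\|\varphi_i(\cdot,\sigma)\|_{\ell^\infty(\Omega_i)}\,\rho(d\sigma)<\infty\quad\text{and}\quad\varphi(\boldsymbol\omega):=\int_\Sigma\prod_{i=1}^m\varphi_i(\omega_i,\sigma)\,\rho(d\sigma)\quad(\boldsymbol\omega\in\Omega),$$ then $$\varphi=\int_\Sigma\varphi_1(\cdot,\sigma)\otimes\cdots\otimes\varphi_m(\cdot,\sigma)\,\rho(d\sigma)\in V(\Omega_1,\ldots,\Omega_m)$$ as a $V(\Omega_1,\ldots,\Omega_m)$-valued Bochner integral, and $$\|\varphi\|_{V(\Omega_1,\ldots,\Omega_m)}\le\int_\Sigma\prod_{i=1}^m\|\varphi_i(\cdot,\sigma)\|_{\ell^\infty(\Omega_i)}\,\rho(d\sigma).$$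
   Context: $C(X)$ denotes complex-valued continuous functions. Product-measurable means $\mathcal B_{\Omega_i}\otimes\mathscr H$-measurable, where $\mathcal B_{\Omega_i}$ is the Borel $\sigma$-algebra. For $f_i\in C(\Omega_i)$, $(f_1\otimes\cdots\otimes f_m)(\boldsymbol\omega):=f_1(\omega_1)\cdots f_m(\omega_m)$. $\|f\|_{\ell^\infty(X)}:=\sup_X|f|$. Varopoulos algebra: for $\varphi\in C(\Omega)$, $\|\varphi\|_{V(\Omega_1,\ldots,\Omega_m)}$ is the infimum of $\sum_{n=1}^\infty\prod_{i=1}^m\|\varphi_{i,n}\|_{\ell^\infty(\Omega_i)}$ over all sequences $(\varphi_{i,n})_{n\in\mathbb N}$ in $C(\Omega_i)$, $i=1,\ldots,m$, such that this sum is finite and $\varphi(\boldsymbol\omega)=\sum_{n=1}^\infty(\varphi_{1,n}\otimes\cdots\otimes\varphi_{m,n})(\boldsymbol\omega)$ for all $\boldsymbol\omega\in\Omega$ ($\infty$ if no such sequences exist). $V(\Omega_1,\ldots,\Omega_m):=\{\varphi\in C(\Omega):\|\varphi\|_{V(\Omega_1,\ldots,\Omega_m)}<\infty\}$, a Banach space with this norm. *)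

theory Defs
  imports "HOL-Analysis.Analysis" "HOL-Library.Function_Algebras"
begin

text \<open>Pointwise real vector space structure on functions, so that the library's
  \<^const>\<open>Bochner_Integration.simple_bochner_integral\<close> applies to function-valued simple functions.\<close>

instantiation "fun" :: (type, real_vector) real_vector
begin

definition scaleR_fun :: "real \<Rightarrow> ('a \<Rightarrow> 'b) \<Rightarrow> 'a \<Rightarrow> 'b"
  where "scaleR_fun c f = (\<lambda>x. c *\<^sub>R f x)"

instance
  by standard (auto simp: scaleR_fun_def fun_eq_iff scaleR_add_right scaleR_add_left)

end

definition borel_of :: "'a topology \<Rightarrow> 'a measure"
  where "borel_of X = sigma (topspace X) {U. openin X U}"

text \<open>A complex function on a space \<open>X\<close> is represented by a total function that vanishes off
  \<^term>\<open>topspace X\<close>; this makes \<open>cfunspace X\<close> (that is, \<open>C(X)\<close>) a linear subspace of the function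
  type, in which functions agreeing on \<open>X\<close> are equal.\<close>

definition on_space :: "'a topology \<Rightarrow> ('a \<Rightarrow> complex) \<Rightarrow> 'a \<Rightarrow> complex"
  where "on_space X f = (\<lambda>x. if x \<in> topspace X then f x else 0)"

definition cfunspace :: "'a topology \<Rightarrow> ('a \<Rightarrow> complex) set"
  where "cfunspace X = {f. continuous_map X euclidean f \<and> (\<forall>x. x \<notin> topspace X \<longrightarrow> f x = 0)}"

text \<open>Taking the supremum in \<^typ>\<open>ennreal\<close> gives the value 0 on the empty space.\<close>

definition sup_norm :: "'a topology \<Rightarrow> ('a \<Rightarrow> complex) \<Rightarrow> ennreal"
  where "sup_norm X f = (SUP x\<in>topspace X. ennreal (cmod (f x)))"

abbreviation prod_space :: "nat \<Rightarrow> (nat \<Rightarrow> 'a topology) \<Rightarrow> (nat \<Rightarrow> 'a) topology"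
  where "prod_space m X \<equiv> product_topology X {1..m}"

definition tensor :: "nat \<Rightarrow> (nat \<Rightarrow> 'a topology) \<Rightarrow> (nat \<Rightarrow> 'a \<Rightarrow> complex) \<Rightarrow> (nat \<Rightarrow> 'a) \<Rightarrow> complex"
  where "tensor m X f = on_space (prod_space m X) (\<lambda>\<omega>. \<Prod>i=1..m. f i (\<omega> i))"

text \<open>The infimum is taken in \<^typ>\<open>ennreal\<close>, so it is \<open>\<infinity>\<close> if there is no admissible representation.\<close>

definition varopoulos_norm ::
    "nat \<Rightarrow> (nat \<Rightarrow> 'a topology) \<Rightarrow> ((nat \<Rightarrow> 'a) \<Rightarrow> complex) \<Rightarrow> ennreal" where
  "varopoulos_norm m X \<phi> =
    Inf {(\<Sum>n. \<Prod>i=1..m. sup_norm (X i) (\<psi> i n)) | \<psi> :: nat \<Rightarrow> nat \<Rightarrow> 'a \<Rightarrow> complex.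
          (\<forall>i\<in>{1..m}. \<forall>n. \<psi> i n \<in> cfunspace (X i)) \<and>
          (\<Sum>n. \<Prod>i=1..m. sup_norm (X i) (\<psi> i n)) < \<infinity> \<and>
          (\<forall>\<omega>\<in>topspace (prod_space m X). (\<lambda>n. tensor m X (\<lambda>i. \<psi> i n) \<omega>) sums \<phi> \<omega>)}"

definition varopoulos :: "nat \<Rightarrow> (nat \<Rightarrow> 'a topology) \<Rightarrow> ((nat \<Rightarrow> 'a) \<Rightarrow> complex) set"
  where "varopoulos m X = {\<phi> \<in> cfunspace (prod_space m X). varopoulos_norm m X \<phi> < \<infinity>}"

text \<open>Bochner integration in a normed space given by a carrier \<open>V\<close> and a norm \<open>N\<close> on it. This is
  the library's \<^const>\<open>has_bochner_integral\<close> with the type-class norm replaced by \<open>N\<close> and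
  measurability replaced by strong measurability (pointwise norm limit of simple functions).\<close>

definition strongly_measurable_in ::
    "'b::real_vector set \<Rightarrow> ('b \<Rightarrow> ennreal) \<Rightarrow> 's measure \<Rightarrow> ('s \<Rightarrow> 'b) \<Rightarrow> bool" where
  "strongly_measurable_in V N M f \<longleftrightarrow>
    f ` space M \<subseteq> V \<and>
    (\<exists>s. (\<forall>k. simple_function M (s k) \<and> s k ` space M \<subseteq> V) \<and>
         (\<forall>\<sigma>\<in>space M. (\<lambda>k. N (f \<sigma> - s k \<sigma>)) \<longlonglongrightarrow> 0))"

definition has_bochner_integral_in ::
    "'b::real_vector set \<Rightarrow> ('b \<Rightarrow> ennreal) \<Rightarrow> 's measure \<Rightarrow> ('s \<Rightarrow> 'b) \<Rightarrow> 'b \<Rightarrow> bool" where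
  "has_bochner_integral_in V N M f x \<longleftrightarrow>
    x \<in> V \<and> strongly_measurable_in V N M f \<and>
    (\<exists>s. (\<forall>k. Bochner_Integration.simple_bochner_integrable M (s k) \<and> s k ` space M \<subseteq> V) \<and>
         (\<lambda>k. \<integral>\<^sup>+\<sigma>. N (f \<sigma> - s k \<sigma>) \<partial>M) \<longlonglongrightarrow> 0 \<and>
         (\<lambda>k. N (Bochner_Integration.simple_bochner_integral M (s k) - x)) \<longlonglongrightarrow> 0)"

end

theory Submission
  imports Defs
begin

text \<open>
  Write \<open>N\<close> for the Varopoulos norm, \<open>f \<sigma>\<close> for the tensor product of the functions
  \<open>\<phi>\<^sub>i(\<cdot>, \<sigma>)\<close>, and \<open>G \<sigma>\<close> for the product of their supremum norms, so that
  \<open>N (f \<sigma>) \<le> G \<sigma>\<close> and \<open>G\<close> is integrable. The proof rests on two facts.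

  The algebra is complete, in the form that \<open>N\<close> is countably subadditive under pointwise
  convergence of series (\<open>varopoulos_norm_suminf\<close>): near-optimal representations of the summands
  are merged along an enumeration of \<open>\<nat> \<times> \<nat>\<close>.

  The function \<open>f\<close> is approximated explicitly by simple functions. On a compact metrizable space
  there are finite nets \<open>F k\<close> with subordinate partitions of unity \<open>h k x\<close>; a continuous \<open>g\<close> is
  the uniform limit of \<open>\<Sum>x\<in>F k. g x \<cdot> h k x\<close>, and the convergence survives rounding
  the values \<open>g x\<close> towards zero to a finite grid. Applied to \<open>g = \<phi>\<^sub>i(\<cdot>, \<sigma>)\<close>, the result
  takes finitely many values as \<open>\<sigma>\<close> varies, because it depends on \<open>\<sigma>\<close> only through finitely
  many rounded numbers, and its supremum norm is at most that of \<open>g\<close>. Tensoring these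
  approximations gives simple functions \<open>s k\<close> with \<open>N (s k \<sigma>) \<le> G \<sigma>\<close>, and a telescoping
  identity for products bounds \<open>N (f \<sigma> - s k \<sigma>)\<close> by a measurable \<open>E k \<sigma> \<le> 2m \<cdot> G \<sigma>\<close>
  that tends to zero. Dominated convergence makes the integrals of \<open>E k\<close> tend to zero. All
  integrands of norms are compared with the measurable functions \<open>E k\<close> and \<open>G\<close>.

  Along a subsequence with \<open>\<integral> E k \<le> 2\<^sup>-\<^sup>n\<close> the integrals of the simple functions converge
  pointwise to \<open>\<Phi>\<close> and have norm-summable increments, so countable subadditivity of \<open>N\<close>,
  applied to the telescoping series, shows that they converge to \<open>\<Phi>\<close> in \<open>N\<close>. The norm
  inequality passes to the limit from \<open>N (\<integral> s k) \<le> \<integral> N (s k) \<le> \<integral> G\<close>.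
\<close>

section \<open>The supremum norm\<close>

lemma sup_norm_upper: "x \<in> topspace X \<Longrightarrow> ennreal (cmod (f x)) \<le> sup_norm X f"
  unfolding sup_norm_def by (rule SUP_upper)

lemma sup_norm_least:
  "(\<And>x. x \<in> topspace X \<Longrightarrow> ennreal (cmod (f x)) \<le> c) \<Longrightarrow> sup_norm X f \<le> c"
  unfolding sup_norm_def by (rule SUP_least)

lemma sup_norm_cong: "(\<And>x. x \<in> topspace X \<Longrightarrow> f x = g x) \<Longrightarrow> sup_norm X f = sup_norm X g"
  unfolding sup_norm_def by (rule SUP_cong) auto

lemma sup_norm_zero [simp]: "sup_norm X (\<lambda>x. 0) = 0"
  by (intro antisym sup_norm_least) auto

lemma sup_norm_finite:
  assumes "compact_space X" "continuous_map X euclidean f"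
  shows "sup_norm X f < \<infinity>"
proof -
  have "compactin euclidean (f ` topspace X)"
    using assms image_compactin compact_space_def by blast
  then have "bounded (f ` topspace X)"
    by (simp add: compact_imp_bounded)
  then obtain B where "\<And>x. x \<in> topspace X \<Longrightarrow> cmod (f x) \<le> B"
    unfolding bounded_iff by auto
  then have "sup_norm X f \<le> ennreal B"
    by (intro sup_norm_least ennreal_leI)
  then show ?thesis
    using ennreal_less_top le_less_trans infinity_ennreal_def by metis
qed

lemma sup_norm_diff: "sup_norm X (\<lambda>x. f x - g x) \<le> sup_norm X f + sup_norm X g"
proof (rule sup_norm_least)
  fix x assume x: "x \<in> topspace X"
  have "ennreal (cmod (f x - g x)) \<le> ennreal (cmod (f x)) + ennreal (cmod (g x))"
    by (simp add: norm_triangle_ineq4 flip: ennreal_plus)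
  also have "\<dots> \<le> sup_norm X f + sup_norm X g"
    using x by (intro add_mono sup_norm_upper)
  finally show "ennreal (cmod (f x - g x)) \<le> sup_norm X f + sup_norm X g" .
qed

lemma sup_norm_scale: "sup_norm X (\<lambda>x. c * f x) = ennreal (cmod c) * sup_norm X f"
  unfolding sup_norm_def by (simp add: norm_mult ennreal_mult SUP_mult_left_ennreal)

lemma continuous_map_on_space:
  "continuous_map X euclidean (on_space X f) \<longleftrightarrow> continuous_map X euclidean f"
  by (auto simp: on_space_def elim!: continuous_map_eq)

lemma on_space_in_cfunspace: "on_space X f \<in> cfunspace X \<longleftrightarrow> continuous_map X euclidean f"
  by (auto simp: cfunspace_def continuous_map_on_space) (simp add: on_space_def)

lemma sup_norm_on_space [simp]: "sup_norm X (on_space X f) = sup_norm X f"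
  by (rule sup_norm_cong) (simp add: on_space_def)

section \<open>The Varopoulos norm\<close>

lemma tensor_apply:
  "\<omega> \<in> topspace (prod_space m X) \<Longrightarrow> tensor m X f \<omega> = (\<Prod>i=1..m. f i (\<omega> i))"
  by (simp add: tensor_def on_space_def)

lemma tensor_off_space: "\<omega> \<notin> topspace (prod_space m X) \<Longrightarrow> tensor m X f \<omega> = 0"
  by (simp add: tensor_def on_space_def)

lemma prod_space_coordinate:
  "\<omega> \<in> topspace (prod_space m X) \<Longrightarrow> i \<in> {1..m} \<Longrightarrow> \<omega> i \<in> topspace (X i)"
  by auto

lemma tensor_cong:
  "(\<And>i x. i \<in> {1..m} \<Longrightarrow> x \<in> topspace (X i) \<Longrightarrow> f i x = g i x) \<Longrightarrow> tensor m X f = tensor m X g"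
  unfolding tensor_def on_space_def
  by (rule ext) (auto intro!: prod.cong dest: PiE_mem)

lemma continuous_map_tensor:
  assumes "\<And>i. i \<in> {1..m} \<Longrightarrow> continuous_map (X i) euclidean (f i)"
  shows "continuous_map (prod_space m X) euclidean (tensor m X f)"
  unfolding tensor_def continuous_map_on_space
  unfolding continuous_map_atin
proof (intro ballI)
  fix \<omega> assume \<omega>: "\<omega> \<in> topspace (prod_space m X)"
  have "continuous_map (prod_space m X) euclidean (\<lambda>\<omega>. f i (\<omega> i))" if i: "i \<in> {1..m}" for i
    using continuous_map_compose[OF continuous_map_product_projection[OF i, of X] assms[OF i]]
    by (simp add: comp_def)
  then show "limitin euclidean (\<lambda>\<omega>. \<Prod>i=1..m. f i (\<omega> i)) (\<Prod>i=1..m. f i (\<omega> i)) (atin (prod_space m X) \<omega>)"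
    using \<omega> by (auto simp: continuous_map_atin intro!: tendsto_prod)
qed

lemma tensor_bound:
  assumes "\<omega> \<in> topspace (prod_space m X)"
  shows "ennreal (cmod (tensor m X f \<omega>)) \<le> (\<Prod>i=1..m. sup_norm (X i) (f i))"
proof -
  have "ennreal (cmod (tensor m X f \<omega>)) = (\<Prod>i=1..m. ennreal (cmod (f i (\<omega> i))))"
    using assms by (simp add: tensor_apply prod_norm prod_ennreal)
  also have "\<dots> \<le> (\<Prod>i=1..m. sup_norm (X i) (f i))"
    using assms by (intro prod_mono_ennreal sup_norm_upper prod_space_coordinate)
  finally show ?thesis .
qed

text \<open>Factors with nonzero values off the spaces are replaced by their extensions by zero, which
  have the same norms and tensor products; the bound is trivial when its right-hand side is infinite.\<close>

lemma varopoulos_norm_le: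
  assumes "\<And>i n. i \<in> {1..m} \<Longrightarrow> continuous_map (X i) euclidean (\<psi> i n)"
    and "\<And>\<omega>. \<omega> \<in> topspace (prod_space m X) \<Longrightarrow> (\<lambda>n. tensor m X (\<lambda>i. \<psi> i n) \<omega>) sums \<phi> \<omega>"
  shows "varopoulos_norm m X \<phi> \<le> (\<Sum>n. \<Prod>i=1..m. sup_norm (X i) (\<psi> i n))"
proof (cases "(\<Sum>n. \<Prod>i=1..m. sup_norm (X i) (\<psi> i n)) < \<infinity>")
  case True
  have eq: "tensor m X (\<lambda>i. on_space (X i) (\<psi> i n)) = tensor m X (\<lambda>i. \<psi> i n)" for n
    by (rule tensor_cong) (simp add: on_space_def)
  show ?thesis
    unfolding varopoulos_norm_def
    by (rule Inf_lower, rule CollectI, rule exI[of _ "\<lambda>i n. on_space (X i) (\<psi> i n)"])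
       (use assms True in \<open>auto simp: on_space_in_cfunspace eq\<close>)
qed (simp add: not_less top_unique)

lemma varopoulos_norm_lessE:
  assumes "varopoulos_norm m X \<phi> < c"
  obtains \<psi> where "\<And>i n. i \<in> {1..m} \<Longrightarrow> continuous_map (X i) euclidean (\<psi> i n)"
    and "(\<Sum>n. \<Prod>i=1..m. sup_norm (X i) (\<psi> i n)) < c"
    and "\<And>\<omega>. \<omega> \<in> topspace (prod_space m X) \<Longrightarrow> (\<lambda>n. tensor m X (\<lambda>i. \<psi> i n) \<omega>) sums \<phi> \<omega>"
proof -
  obtain \<psi> where "\<forall>i\<in>{1..m}. \<forall>n. \<psi> i n \<in> cfunspace (X i)"
    "(\<Sum>n. \<Prod>i=1..m. sup_norm (X i) (\<psi> i n)) < c"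
    "\<forall>\<omega>\<in>topspace (prod_space m X). (\<lambda>n. tensor m X (\<lambda>i. \<psi> i n) \<omega>) sums \<phi> \<omega>"
    using assms unfolding varopoulos_norm_def Inf_less_iff by auto
  then show thesis
    by (intro that[of \<psi>]) (auto simp: cfunspace_def)
qed

lemma varopoulos_norm_cong:
  "(\<And>\<omega>. \<omega> \<in> topspace (prod_space m X) \<Longrightarrow> \<phi> \<omega> = \<psi> \<omega>) \<Longrightarrow>
    varopoulos_norm m X \<phi> = varopoulos_norm m X \<psi>"
  unfolding varopoulos_norm_def by (simp cong: conj_cong)

text \<open>The representation with a single nonzero term. Padding it with zero factors works only when
  there is at least one factor, since an empty product is one.\<close>

lemma varopoulos_norm_tensor:
  assumes m: "m \<ge> 1"
    and f: "\<And>i. i \<in> {1..m} \<Longrightarrow> continuous_map (X i) euclidean (f i)"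
  shows "varopoulos_norm m X (tensor m X f) \<le> (\<Prod>i=1..m. sup_norm (X i) (f i))"
proof -
  define \<psi> where "\<psi> i n = (if n = 0 then f i else (\<lambda>x. 0))" for i and n :: nat
  have z: "tensor m X (\<lambda>i. \<psi> i n) \<omega> = 0" if "n \<notin> {0}" for n \<omega>
    using m that by (cases "\<omega> \<in> topspace (prod_space m X)")
      (auto simp: tensor_apply tensor_off_space \<psi>_def prod_zero_iff)
  have z': "(\<Prod>i=1..m. sup_norm (X i) (\<psi> i n)) = 0" if "n \<notin> {0}" for n
    using m that by (auto simp: \<psi>_def)
  have "varopoulos_norm m X (tensor m X f) \<le> (\<Sum>n. \<Prod>i=1..m. sup_norm (X i) (\<psi> i n))"
  proof (rule varopoulos_norm_le)
    show "(\<lambda>n. tensor m X (\<lambda>i. \<psi> i n) \<omega>) sums tensor m X f \<omega>" for \<omega>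
      using sums_finite[of "{0}" "\<lambda>n. tensor m X (\<lambda>i. \<psi> i n) \<omega>"] z
      by (simp add: \<psi>_def)
  qed (auto simp: \<psi>_def f)
  also have "\<dots> = (\<Prod>i=1..m. sup_norm (X i) (f i))"
    using suminf_finite[of "{0}" "\<lambda>n. \<Prod>i=1..m. sup_norm (X i) (\<psi> i n)"] z'
    by (simp add: \<psi>_def)
  finally show ?thesis .
qed

lemma varopoulos_norm_zero:
  assumes "m \<ge> 1" shows "varopoulos_norm m X (\<lambda>\<omega>. 0) = 0"
proof -
  have "tensor m X (\<lambda>i x. 0) = (\<lambda>\<omega>. 0)"
    using assms by (auto simp: tensor_def on_space_def)
  moreover have "(\<Prod>i=1..m. sup_norm (X i) (\<lambda>x. 0)) = 0"
    using assms by (intro prod_zero) auto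
  moreover have "varopoulos_norm m X (tensor m X (\<lambda>i x. 0)) \<le> (\<Prod>i=1..m. sup_norm (X i) (\<lambda>x. 0))"
    using assms by (rule varopoulos_norm_tensor) simp
  ultimately show ?thesis by (metis le_zero_eq)
qed

text \<open>Absolute convergence of the reindexed double series lets it be summed row by row.\<close>

lemma sums_prod_decode:
  fixes T :: "nat \<times> nat \<Rightarrow> complex"
  assumes abs: "summable (\<lambda>l. cmod (T (prod_decode l)))"
    and rows: "\<And>n. (\<lambda>j. T (n, j)) sums a n" and a: "a sums s"
  shows "(\<lambda>l. T (prod_decode l)) sums s"
proof -
  define S where "S = (\<Sum>l. T (prod_decode l))"
  have S: "(\<lambda>l. T (prod_decode l)) sums S"
    using abs by (simp add: S_def summable_norm_cancel summable_sums)
  have "((T \<circ> prod_decode) has_sum S) UNIV"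
    using norm_summable_imp_has_sum[OF abs S] by (simp add: comp_def)
  then have T: "(T has_sum S) (UNIV \<times> UNIV)"
    using has_sum_reindex[OF inj_prod_decode[of UNIV], of T S] by (simp add: surj_prod_decode)
  have row: "((\<lambda>j. T (n, j)) has_sum a n) UNIV" for n
  proof -
    have "T summable_on Pair n ` UNIV"
      by (rule summable_on_subset_banach[OF has_sum_imp_summable[OF T]]) auto
    then have "(\<lambda>j. T (n, j)) summable_on UNIV"
      by (simp add: summable_on_reindex inj_on_def comp_def)
    then show ?thesis
      using has_sum_imp_sums rows sums_unique2 by (metis has_sum_infsum)
  qed
  have "(a has_sum S) UNIV"
    by (rule has_sum_Sigma'[OF T row])
  then have "S = s"
    using has_sum_imp_sums a sums_unique2 by blast
  with S show ?thesis by simp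
qed

text \<open>This carries the completeness of the Varopoulos algebra. Each summand has a representation
  within \<open>e / 2\<^sup>n\<^sup>+\<^sup>1\<close> of its norm; enumerating all their terms as one sequence represents the sum.\<close>

lemma varopoulos_norm_suminf:
  assumes sums: "\<And>\<omega>. \<omega> \<in> topspace (prod_space m X) \<Longrightarrow> (\<lambda>n. \<phi> n \<omega>) sums \<Phi> \<omega>"
  shows "varopoulos_norm m X \<Phi> \<le> (\<Sum>n. varopoulos_norm m X (\<phi> n))"
proof (rule ennreal_le_epsilon)
  fix e :: real
  assume fin: "(\<Sum>n. varopoulos_norm m X (\<phi> n)) < top" and e: "0 < e"
  have finn: "varopoulos_norm m X (\<phi> n) < top" for n
    by (rule ennreal_suminf_lessD[OF fin])
  define \<epsilon> where "\<epsilon> n = ennreal (e * (1/2) ^ Suc n)" for n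
  define admissible where "admissible n \<psi> \<longleftrightarrow>
      (\<forall>i\<in>{1..m}. \<forall>j. continuous_map (X i) euclidean (\<psi> i j)) \<and>
      (\<Sum>j. \<Prod>i=1..m. sup_norm (X i) (\<psi> i j)) < varopoulos_norm m X (\<phi> n) + \<epsilon> n \<and>
      (\<forall>\<omega>\<in>topspace (prod_space m X). (\<lambda>j. tensor m X (\<lambda>i. \<psi> i j) \<omega>) sums \<phi> n \<omega>)"
    for n \<psi>
  have "\<exists>\<psi>. admissible n \<psi>" for n
  proof -
    have "varopoulos_norm m X (\<phi> n) < varopoulos_norm m X (\<phi> n) + \<epsilon> n"
      using finn[of n] e by (simp add: \<epsilon>_def ennreal_add_left_cancel_less[of _ 0, simplified])
    then show ?thesis
      unfolding admissible_def by (rule varopoulos_norm_lessE) blast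
  qed
  then obtain \<Psi> where \<Psi>': "\<And>n. admissible n (\<Psi> n)"
    by metis
  then have \<Psi>: "\<And>n i j. i \<in> {1..m} \<Longrightarrow> continuous_map (X i) euclidean (\<Psi> n i j)"
      "\<And>n. (\<Sum>j. \<Prod>i=1..m. sup_norm (X i) (\<Psi> n i j)) < varopoulos_norm m X (\<phi> n) + \<epsilon> n"
      "\<And>n \<omega>. \<omega> \<in> topspace (prod_space m X) \<Longrightarrow>
          (\<lambda>j. tensor m X (\<lambda>i. \<Psi> n i j) \<omega>) sums \<phi> n \<omega>"
    unfolding admissible_def by blast+
  define P where "P = (\<lambda>(n, j). \<Prod>i=1..m. sup_norm (X i) (\<Psi> n i j))"
  have P_sum: "(\<Sum>l. P (prod_decode l)) = (\<Sum>n. \<Sum>j. P (n, j))"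
    by (rule suminf_ennreal_2dimen) simp
  have "(\<Sum>n. \<Sum>j. P (n, j)) \<le> (\<Sum>n. varopoulos_norm m X (\<phi> n) + \<epsilon> n)"
    using \<Psi>(2) by (intro suminf_le) (auto simp: P_def intro: less_imp_le)
  also have "\<dots> = (\<Sum>n. varopoulos_norm m X (\<phi> n)) + (\<Sum>n. \<epsilon> n)"
    by (simp add: suminf_add)
  also have "(\<Sum>n. \<epsilon> n) = ennreal e"
  proof -
    have "(\<lambda>n. e * (1/2) ^ Suc n) sums (e * 1)"
      by (intro sums_mult power_half_series)
    then show ?thesis
      unfolding \<epsilon>_def using e by (intro suminf_ennreal_eq) auto
  qed
  finally have bound: "(\<Sum>l. P (prod_decode l)) \<le> (\<Sum>n. varopoulos_norm m X (\<phi> n)) + ennreal e"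
    unfolding P_sum .
  define \<psi> where "\<psi> i l = (case prod_decode l of (n, j) \<Rightarrow> \<Psi> n i j)" for i l
  have "varopoulos_norm m X \<Phi> \<le> (\<Sum>l. \<Prod>i=1..m. sup_norm (X i) (\<psi> i l))"
  proof (rule varopoulos_norm_le)
    show "continuous_map (X i) euclidean (\<psi> i l)" if "i \<in> {1..m}" for i l
      using \<Psi>(1)[OF that] by (simp add: \<psi>_def split: prod.split)
  next
    fix \<omega> assume \<omega>: "\<omega> \<in> topspace (prod_space m X)"
    define T where "T = (\<lambda>(n, j). tensor m X (\<lambda>i. \<Psi> n i j) \<omega>)"
    have T: "tensor m X (\<lambda>i. \<psi> i l) \<omega> = T (prod_decode l)" for l
      by (simp add: T_def \<psi>_def split: prod.split)
    have TP: "ennreal (cmod (T p)) \<le> P p" for p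
      unfolding T_def P_def case_prod_unfold by (rule tensor_bound[OF \<omega>])
    have "(\<Sum>l. ennreal (cmod (T (prod_decode l)))) \<le> (\<Sum>l. P (prod_decode l))"
      by (intro suminf_le TP) auto
    also have "\<dots> < top"
      using bound fin by (simp add: le_less_trans)
    finally have "summable (\<lambda>l. cmod (T (prod_decode l)))"
      by (intro summable_suminf_not_top) auto
    then have "(\<lambda>l. T (prod_decode l)) sums \<Phi> \<omega>"
      by (rule sums_prod_decode) (use \<Psi>(3) sums \<omega> in \<open>auto simp: T_def\<close>)
    then show "(\<lambda>l. tensor m X (\<lambda>i. \<psi> i l) \<omega>) sums \<Phi> \<omega>"
      by (simp add: T)
  qed
  also have "\<dots> = (\<Sum>l. P (prod_decode l))"
    by (simp add: P_def \<psi>_def case_prod_unfold)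
  finally show "varopoulos_norm m X \<Phi> \<le> (\<Sum>n. varopoulos_norm m X (\<phi> n)) + ennreal e"
    using bound by (rule order_trans)
qed

lemma varopoulos_norm_sum:
  assumes "m \<ge> 1" "finite I"
  shows "varopoulos_norm m X (\<lambda>\<omega>. \<Sum>i\<in>I. \<phi> i \<omega>) \<le> (\<Sum>i\<in>I. varopoulos_norm m X (\<phi> i))"
proof -
  obtain e where e: "bij_betw e {..<card I} I"
    using assms(2) ex_bij_betw_nat_finite[of I] by (auto simp: lessThan_atLeast0)
  define \<psi> where "\<psi> n = (if n < card I then \<phi> (e n) else (\<lambda>\<omega>. 0))" for n
  have eq: "(\<Sum>i\<in>I. F (\<phi> i)) = (\<Sum>n<card I. F (\<psi> n))" for F :: "_ \<Rightarrow> 'z::comm_monoid_add"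
    by (simp add: \<psi>_def sum.reindex_bij_betw[OF e, symmetric])
  have "varopoulos_norm m X (\<lambda>\<omega>. \<Sum>i\<in>I. \<phi> i \<omega>) \<le> (\<Sum>n. varopoulos_norm m X (\<psi> n))"
  proof (rule varopoulos_norm_suminf)
    fix \<omega>
    have "(\<lambda>n. \<psi> n \<omega>) sums (\<Sum>n<card I. \<psi> n \<omega>)"
      by (rule sums_finite) (auto simp: \<psi>_def)
    then show "(\<lambda>n. \<psi> n \<omega>) sums (\<Sum>i\<in>I. \<phi> i \<omega>)"
      using eq[of "\<lambda>f. f \<omega>"] by simp
  qed
  also have "\<dots> = (\<Sum>n<card I. varopoulos_norm m X (\<psi> n))"
    by (rule suminf_finite) (auto simp: \<psi>_def varopoulos_norm_zero[OF assms(1)])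
  finally show ?thesis
    using eq[of "varopoulos_norm m X"] by simp
qed

lemma varopoulos_norm_add:
  assumes "m \<ge> 1"
  shows "varopoulos_norm m X (\<lambda>\<omega>. \<phi> \<omega> + \<psi> \<omega>) \<le> varopoulos_norm m X \<phi> + varopoulos_norm m X \<psi>"
  using varopoulos_norm_sum[OF assms, of "{True, False}" X "\<lambda>b. if b then \<phi> else \<psi>"] by simp

lemma varopoulos_norm_scale:
  assumes m: "m \<ge> 1"
  shows "varopoulos_norm m X (\<lambda>\<omega>. c * \<phi> \<omega>) \<le> ennreal (cmod c) * varopoulos_norm m X \<phi>"
proof (cases "c = 0")
  case False
  have "varopoulos_norm m X (\<lambda>\<omega>. c * \<phi> \<omega>) / ennreal (cmod c) \<le> S"
    if "varopoulos_norm m X \<phi> < S" for S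
  proof -
    from that obtain \<psi> where \<psi>: "\<And>i n. i \<in> {1..m} \<Longrightarrow> continuous_map (X i) euclidean (\<psi> i n)"
      "(\<Sum>n. \<Prod>i=1..m. sup_norm (X i) (\<psi> i n)) < S"
      "\<And>\<omega>. \<omega> \<in> topspace (prod_space m X) \<Longrightarrow> (\<lambda>n. tensor m X (\<lambda>i. \<psi> i n) \<omega>) sums \<phi> \<omega>"
      by (rule varopoulos_norm_lessE) blast
    \<comment> \<open>The scalar is absorbed into the first factor.\<close>
    define \<psi>' where "\<psi>' i n = (if i = 1 then (\<lambda>x. c * \<psi> i n x) else \<psi> i n)" for i n
    have split: "{1..m} = insert 1 {2..m}" using m by auto
    have "varopoulos_norm m X (\<lambda>\<omega>. c * \<phi> \<omega>) \<le> (\<Sum>n. \<Prod>i=1..m. sup_norm (X i) (\<psi>' i n))"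
    proof (rule varopoulos_norm_le)
      show "continuous_map (X i) euclidean (\<psi>' i n)" if "i \<in> {1..m}" for i n
        using \<psi>(1)[OF that, of n] by (auto simp: \<psi>'_def continuous_map_atin intro!: tendsto_mult)
    next
      fix \<omega> assume \<omega>: "\<omega> \<in> topspace (prod_space m X)"
      have "tensor m X (\<lambda>i. \<psi>' i n) \<omega> = c * tensor m X (\<lambda>i. \<psi> i n) \<omega>" for n
        unfolding tensor_apply[OF \<omega>] split by (simp add: \<psi>'_def mult.assoc)
      then show "(\<lambda>n. tensor m X (\<lambda>i. \<psi>' i n) \<omega>) sums (c * \<phi> \<omega>)"
        using sums_mult[OF \<psi>(3)[OF \<omega>], of c] by simp
    qed
    also have "(\<lambda>n. \<Prod>i=1..m. sup_norm (X i) (\<psi>' i n)) =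
        (\<lambda>n. ennreal (cmod c) * (\<Prod>i=1..m. sup_norm (X i) (\<psi> i n)))"
      unfolding split by (simp add: \<psi>'_def mult.assoc sup_norm_scale)
    also have "(\<Sum>n. ennreal (cmod c) * (\<Prod>i=1..m. sup_norm (X i) (\<psi> i n))) \<le> ennreal (cmod c) * S"
      using \<psi>(2) by (simp add: mult_left_mono less_imp_le)
    finally show ?thesis
      using False by (simp add: divide_le_posI_ennreal mult.commute)
  qed
  then have "varopoulos_norm m X (\<lambda>\<omega>. c * \<phi> \<omega>) / ennreal (cmod c) \<le> varopoulos_norm m X \<phi>"
    by (rule dense_ge)
  then have "ennreal (cmod c) * (varopoulos_norm m X (\<lambda>\<omega>. c * \<phi> \<omega>) / ennreal (cmod c)) \<le>
      ennreal (cmod c) * varopoulos_norm m X \<phi>"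
    by (rule mult_left_mono) simp
  then show ?thesis
    using False by (simp add: ennreal_times_divide mult.commute[of "ennreal (cmod c)"] ennreal_mult_divide_eq)
qed (simp add: varopoulos_norm_zero[OF m])

lemma varopoulos_norm_diff:
  assumes "m \<ge> 1"
  shows "varopoulos_norm m X (\<lambda>\<omega>. \<phi> \<omega> - \<psi> \<omega>) \<le> varopoulos_norm m X \<phi> + varopoulos_norm m X \<psi>"
proof -
  have "varopoulos_norm m X (\<lambda>\<omega>. \<phi> \<omega> - \<psi> \<omega>) \<le>
      varopoulos_norm m X \<phi> + varopoulos_norm m X (\<lambda>\<omega>. - 1 * \<psi> \<omega>)"
    using varopoulos_norm_add[OF assms, of X \<phi> "\<lambda>\<omega>. - 1 * \<psi> \<omega>"] by simp
  also have "varopoulos_norm m X (\<lambda>\<omega>. - 1 * \<psi> \<omega>) \<le> varopoulos_norm m X \<psi>"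
    using varopoulos_norm_scale[OF assms, of X "- 1" \<psi>] by simp
  finally show ?thesis by (simp add: add_left_mono)
qed

text \<open>The norm dominates the supremum norm, since each term of a representation does so.\<close>

lemma varopoulos_norm_upper:
  assumes \<omega>: "\<omega> \<in> topspace (prod_space m X)"
  shows "ennreal (cmod (\<phi> \<omega>)) \<le> varopoulos_norm m X \<phi>"
proof (rule dense_ge)
  fix c assume "varopoulos_norm m X \<phi> < c"
  then obtain \<psi> where \<psi>:
      "(\<Sum>n. \<Prod>i=1..m. sup_norm (X i) (\<psi> i n)) < c"
      "\<And>\<omega>. \<omega> \<in> topspace (prod_space m X) \<Longrightarrow> (\<lambda>n. tensor m X (\<lambda>i. \<psi> i n) \<omega>) sums \<phi> \<omega>"
    by (rule varopoulos_norm_lessE) blast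
  have "(\<Sum>n. ennreal (cmod (tensor m X (\<lambda>i. \<psi> i n) \<omega>))) \<le>
      (\<Sum>n. \<Prod>i=1..m. sup_norm (X i) (\<psi> i n))"
    by (intro suminf_le tensor_bound[OF \<omega>]) auto
  also note \<psi>(1)
  finally have less: "(\<Sum>n. ennreal (cmod (tensor m X (\<lambda>i. \<psi> i n) \<omega>))) < c" .
  then have sm: "summable (\<lambda>n. cmod (tensor m X (\<lambda>i. \<psi> i n) \<omega>))"
    by (intro summable_suminf_not_top) auto
  have "ennreal (cmod (\<phi> \<omega>)) \<le> ennreal (\<Sum>n. cmod (tensor m X (\<lambda>i. \<psi> i n) \<omega>))"
    using summable_norm[OF sm] sums_unique[OF \<psi>(2)[OF \<omega>]] by (simp add: ennreal_leI)
  also have "\<dots> = (\<Sum>n. ennreal (cmod (tensor m X (\<lambda>i. \<psi> i n) \<omega>)))"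
    by (rule suminf_ennreal2[symmetric]) (auto simp: sm)
  finally show "ennreal (cmod (\<phi> \<omega>)) \<le> c" using less by simp
qed

lemma continuous_map_complex_uniform_limit:
  fixes g :: "'a \<Rightarrow> complex"
  assumes f: "\<And>n::nat. continuous_map X euclidean (f n)"
    and dist: "\<And>n x. x \<in> topspace X \<Longrightarrow> ennreal (cmod (g x - f n x)) \<le> e n"
    and e: "e \<longlonglongrightarrow> 0"
  shows "continuous_map X euclidean g"
proof -
  have "continuous_map X Met_TC.mtopology g"
  proof (rule Met_TC.continuous_map_uniform_limit)
    show "\<forall>\<^sub>F n in sequentially. continuous_map X Met_TC.mtopology (f n)"
      using f by simp
    show "\<forall>\<^sub>F n in sequentially. \<forall>x\<in>topspace X. g x \<in> UNIV \<and> dist (f n x) (g x) < \<epsilon>"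
      if "0 < \<epsilon>" for \<epsilon> :: real
    proof -
      have "\<forall>\<^sub>F n in sequentially. e n < ennreal \<epsilon>"
        using order_tendstoD(2)[OF e, of "ennreal \<epsilon>"] that by simp
      then show ?thesis
      proof eventually_elim
        case (elim n)
        then have "ennreal (cmod (g x - f n x)) < ennreal \<epsilon>" if "x \<in> topspace X" for x
          using dist[OF that, of n] by (rule le_less_trans[rotated])
        then show ?case
          by (auto simp: dist_norm norm_minus_commute ennreal_less_iff)
      qed
    qed
  qed simp
  then show ?thesis by simp
qed

lemma suminf_tail_tendsto_zero:
  fixes f :: "nat \<Rightarrow> ennreal"
  assumes "suminf f < \<infinity>"
  shows "(\<lambda>k. \<Sum>n. f (n + k)) \<longlonglongrightarrow> 0"
proof -
  define g where "g n = enn2real (f n)" for n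
  have f: "f n = ennreal (g n)" for n
    using ennreal_suminf_lessD[of f top n] assms by (simp add: g_def)
  have sm: "summable g"
    by (rule summable_suminf_not_top) (use assms in \<open>auto simp: g_def f[unfolded g_def, symmetric]\<close>)
  have eq: "(\<Sum>n. f (n + k)) = ennreal (\<Sum>n. g (n + k))" for k
    unfolding f
    by (rule suminf_ennreal2[OF _ summable_ignore_initial_segment[OF sm]]) (simp add: g_def)
  show ?thesis
    unfolding eq using tendsto_ennrealI[OF suminf_exist_split2[OF sm]] by simp
qed

text \<open>Tails of an admissible representation tend to zero in the dominating norm, so its partial
  sums converge uniformly, with continuous limit.\<close>

lemma varopoulos_norm_finite_imp_continuous:
  assumes "varopoulos_norm m X \<phi> < \<infinity>"
  shows "continuous_map (prod_space m X) euclidean \<phi>"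
proof -
  from assms obtain \<psi> where \<psi>: "\<And>i n. i \<in> {1..m} \<Longrightarrow> continuous_map (X i) euclidean (\<psi> i n)"
      "(\<Sum>n. \<Prod>i=1..m. sup_norm (X i) (\<psi> i n)) < \<infinity>"
      "\<And>\<omega>. \<omega> \<in> topspace (prod_space m X) \<Longrightarrow> (\<lambda>n. tensor m X (\<lambda>i. \<psi> i n) \<omega>) sums \<phi> \<omega>"
    by (rule varopoulos_norm_lessE) blast
  define P where "P n = (\<Prod>i=1..m. sup_norm (X i) (\<psi> i n))" for n
  define S where "S k = (\<lambda>\<omega>. \<Sum>n<k. tensor m X (\<lambda>i. \<psi> i n) \<omega>)" for k
  show ?thesis
  proof (rule continuous_map_complex_uniform_limit)
    show "continuous_map (prod_space m X) euclidean (S k)" for k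
      unfolding S_def using \<psi>(1) by (intro continuous_map_sum continuous_map_tensor) auto
    show "(\<lambda>k. \<Sum>n. P (n + k)) \<longlonglongrightarrow> 0"
      using \<psi>(2) by (intro suminf_tail_tendsto_zero) (simp add: P_def)
    fix k \<omega> assume \<omega>: "\<omega> \<in> topspace (prod_space m X)"
    have "ennreal (cmod (\<phi> \<omega> - S k \<omega>)) \<le>
        varopoulos_norm m X (\<lambda>\<omega>. \<phi> \<omega> - S k \<omega>)"
      by (rule varopoulos_norm_upper[OF \<omega>])
    also have "\<dots> \<le> (\<Sum>n. P (n + k))"
      unfolding P_def
      by (rule varopoulos_norm_le)
         (use \<psi>(1) sums_split_initial_segment[OF \<psi>(3)] in \<open>auto simp: S_def simp del: topspace_product_topology\<close>)
    finally show "ennreal (cmod (\<phi> \<omega> - S k \<omega>)) \<le> (\<Sum>n. P (n + k))" .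
  qed
qed

lemma varopoulos_iff:
  "\<phi> \<in> varopoulos m X \<longleftrightarrow>
    (\<forall>\<omega>. \<omega> \<notin> topspace (prod_space m X) \<longrightarrow> \<phi> \<omega> = 0) \<and> varopoulos_norm m X \<phi> < \<infinity>"
  using varopoulos_norm_finite_imp_continuous[of m X \<phi>] by (auto simp: varopoulos_def cfunspace_def)

text \<open>The factors \<open>a i\<close> are exchanged for \<open>b i\<close> one at a time, from left to right.\<close>

lemma prod_diff_telescope:
  fixes a b :: "nat \<Rightarrow> 'a::comm_ring_1"
  shows "(\<Prod>i=1..m. a i) - (\<Prod>i=1..m. b i) =
    (\<Sum>j=1..m. \<Prod>i=1..m. if i < j then b i else if i = j then a i - b i else a i)"
proof (induction m)
  case (Suc m)
  let ?t = "\<lambda>j i. if i < j then b i else if i = j then a i - b i else a i"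
  have 1: "(\<Prod>i=1..Suc m. ?t j i) = (\<Prod>i=1..m. ?t j i) * a (Suc m)" if "j \<in> {1..m}" for j
    using that by simp
  have 2: "(\<Prod>i=1..Suc m. ?t (Suc m) i) = (\<Prod>i=1..m. b i) * (a (Suc m) - b (Suc m))"
    by simp
  have "(\<Sum>j=1..m. \<Prod>i=1..Suc m. ?t j i) = (\<Sum>j=1..m. \<Prod>i=1..m. ?t j i) * a (Suc m)"
    unfolding sum_distrib_right by (rule sum.cong[OF refl 1])
  then have "(\<Sum>j=1..Suc m. \<Prod>i=1..Suc m. ?t j i) =
      (\<Sum>j=1..m. \<Prod>i=1..m. ?t j i) * a (Suc m) + (\<Prod>i=1..m. b i) * (a (Suc m) - b (Suc m))"
    using 2 by (simp only: sum.cl_ivl_Suc) simp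
  also have "\<dots> = (\<Prod>i=1..Suc m. a i) - (\<Prod>i=1..Suc m. b i)"
    unfolding Suc.IH[symmetric] by (simp add: algebra_simps)
  finally show ?case by simp
qed simp

text \<open>Replacing the norms of the exchanged factors \<open>b i\<close> by those of \<open>a i\<close> makes the coefficients of
  the factor errors independent of the approximation \<open>b\<close>.\<close>

lemma varopoulos_norm_tensor_diff:
  assumes m: "m \<ge> 1"
    and a: "\<And>i. i \<in> {1..m} \<Longrightarrow> continuous_map (X i) euclidean (a i)"
    and b: "\<And>i. i \<in> {1..m} \<Longrightarrow> continuous_map (X i) euclidean (b i)"
    and le: "\<And>i. i \<in> {1..m} \<Longrightarrow> sup_norm (X i) (b i) \<le> sup_norm (X i) (a i)"
  shows "varopoulos_norm m X (\<lambda>\<omega>. tensor m X a \<omega> - tensor m X b \<omega>) \<le>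
    (\<Sum>j=1..m. sup_norm (X j) (\<lambda>x. a j x - b j x) * (\<Prod>i\<in>{1..m}-{j}. sup_norm (X i) (a i)))"
proof -
  define t where "t j i = (if i < j then b i else if i = j then (\<lambda>x. a i x - b i x) else a i)" for j i
  have "varopoulos_norm m X (\<lambda>\<omega>. tensor m X a \<omega> - tensor m X b \<omega>) =
      varopoulos_norm m X (\<lambda>\<omega>. \<Sum>j=1..m. tensor m X (t j) \<omega>)"
  proof (rule varopoulos_norm_cong)
    fix \<omega> assume \<omega>: "\<omega> \<in> topspace (prod_space m X)"
    show "tensor m X a \<omega> - tensor m X b \<omega> = (\<Sum>j=1..m. tensor m X (t j) \<omega>)"
      unfolding tensor_apply[OF \<omega>] prod_diff_telescope by (intro sum.cong prod.cong) (auto simp: t_def)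
  qed
  also have "\<dots> \<le> (\<Sum>j=1..m. varopoulos_norm m X (tensor m X (t j)))"
    using m by (rule varopoulos_norm_sum) simp
  also have "\<dots> \<le> (\<Sum>j=1..m. \<Prod>i=1..m. sup_norm (X i) (t j i))"
    by (intro sum_mono varopoulos_norm_tensor m) (auto simp: t_def intro!: a b continuous_map_diff)
  also have "\<dots> \<le> (\<Sum>j=1..m. sup_norm (X j) (\<lambda>x. a j x - b j x) *
      (\<Prod>i\<in>{1..m}-{j}. sup_norm (X i) (a i)))"
  proof (rule sum_mono)
    fix j assume j: "j \<in> {1..m}"
    have "(\<Prod>i=1..m. sup_norm (X i) (t j i)) =
        sup_norm (X j) (t j j) * (\<Prod>i\<in>{1..m}-{j}. sup_norm (X i) (t j i))"
      using j by (intro prod.remove) auto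
    also have "\<dots> \<le> sup_norm (X j) (\<lambda>x. a j x - b j x) * (\<Prod>i\<in>{1..m}-{j}. sup_norm (X i) (a i))"
      by (intro mult_mono prod_mono_ennreal) (auto simp: t_def le)
    finally show "(\<Prod>i=1..m. sup_norm (X i) (t j i)) \<le>
        sup_norm (X j) (\<lambda>x. a j x - b j x) * (\<Prod>i\<in>{1..m}-{j}. sup_norm (X i) (a i))" .
  qed
  finally show ?thesis .
qed

section \<open>Finite nets with partitions of unity\<close>

text \<open>The metric is hidden: the last clause keeps only what is needed of shrinking supports, namely
  that the oscillation of every continuous function on the support of \<open>h k x\<close> becomes small
  uniformly in \<open>x\<close>.\<close>

definition net_partition :: "'a topology \<Rightarrow> (nat \<Rightarrow> 'a set) \<Rightarrow> (nat \<Rightarrow> 'a \<Rightarrow> 'a \<Rightarrow> real) \<Rightarrow> bool" where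
  "net_partition X F h \<longleftrightarrow>
    (\<forall>k. finite (F k) \<and> F k \<subseteq> topspace X) \<and>
    (\<forall>k x. x \<in> F k \<longrightarrow> continuous_map X euclideanreal (h k x)) \<and>
    (\<forall>k x y. 0 \<le> h k x y) \<and>
    (\<forall>k. \<forall>y\<in>topspace X. (\<Sum>x\<in>F k. h k x y) = 1) \<and>
    (\<forall>g :: 'a \<Rightarrow> complex. continuous_map X euclidean g \<longrightarrow> (\<forall>\<epsilon>>0. \<forall>\<^sub>F k in sequentially.
      \<forall>y\<in>topspace X. \<forall>x\<in>F k. h k x y \<noteq> 0 \<longrightarrow> cmod (g x - g y) < \<epsilon>))"

text \<open>Take \<open>F k\<close> to be a \<open>1/(k+1)\<close>-net and normalise the tent functions
  \<open>max 0 (1/(k+1) - d x y)\<close>; their sum is positive because \<open>F k\<close> is a net, and the oscillation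
  clause is uniform continuity.\<close>

lemma net_partition_exists:
  assumes "compact_space X" "metrizable_space X"
  shows "\<exists>F h. net_partition X F h"
proof -
  obtain M d where "Metric_space M d" and X0: "X = Metric_space.mtopology M d"
    using assms(2) unfolding metrizable_space_def by blast
  then interpret Metric_space M d by simp
  define mm where "mm = metric (M, d)"
  have mm: "mspace mm = M" "mdist mm = d" "mtopology_of mm = X"
    by (auto simp: mm_def X0 mtopology_of_def)
  have top: "topspace X = M" by (simp add: X0)
  have tb: "mtotally_bounded M"
    using compactin_imp_mtotally_bounded[of M] assms(1) top X0 by (simp add: compact_space_def)
  define r where "r k = 1 / real (Suc k)" for k
  have r: "r k > 0" for k by (simp add: r_def)
  have "\<exists>K. finite K \<and> K \<subseteq> M \<and> M \<subseteq> (\<Union>x\<in>K. mball x (r k))" for k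
    using tb r[of k] unfolding mtotally_bounded_def by blast
  then obtain F where F: "\<And>k. finite (F k)" "\<And>k. F k \<subseteq> M" "\<And>k. M \<subseteq> (\<Union>x\<in>F k. mball x (r k))"
    by metis
  define a where "a k x y = max 0 (r k - d x y)" for k x y
  define h where "h k x y = a k x y / (\<Sum>z\<in>F k. a k z y)" for k x y
  have a0: "0 \<le> a k x y" for k x y by (simp add: a_def)
  have a_pos: "0 < (\<Sum>z\<in>F k. a k z y)" if "y \<in> M" for k y
  proof -
    from F(3)[of k] that obtain x where x: "x \<in> F k" "y \<in> mball x (r k)" by blast
    then show ?thesis
      using F(1) by (intro sum_pos2[of _ x]) (auto simp: a_def)
  qed
  have a_cont: "continuous_map X euclideanreal (a k x)" if "x \<in> F k" for k x
  proof -
    have "continuous_map X euclideanreal (\<lambda>y. mdist mm x y)"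
      using that F(2)[of k] top by (intro continuous_map_mdist) (auto simp: mm)
    then show ?thesis
      unfolding a_def mm(2) by (intro continuous_intros) auto
  qed
  have "net_partition X F h"
    unfolding net_partition_def
  proof (intro conjI allI impI ballI)
    show "finite (F k)" "F k \<subseteq> topspace X" for k
      using F top by auto
    show "continuous_map X euclideanreal (h k x)" if "x \<in> F k" for k x
      unfolding h_def using that a_pos top F(1)
      by (intro continuous_map_real_divide continuous_map_sum a_cont) (auto simp: less_imp_neq[THEN not_sym])
    show "0 \<le> h k x y" for k x y
      unfolding h_def by (intro divide_nonneg_nonneg sum_nonneg a0)
    show "(\<Sum>x\<in>F k. h k x y) = 1" if "y \<in> topspace X" for k y
      using a_pos[of y k] that top unfolding h_def sum_divide_distrib[symmetric] by simp
    fix g :: "'a \<Rightarrow> complex" and \<epsilon> :: real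
    assume g: "continuous_map X euclidean g" and \<epsilon>: "\<epsilon> > 0"
    have "uniformly_continuous_map mm euclidean_metric g"
      using g assms(1) by (intro continuous_imp_uniformly_continuous_map) (simp add: mm)
    then obtain \<delta> where \<delta>: "\<delta> > 0"
        "\<And>x y. x \<in> M \<Longrightarrow> y \<in> M \<Longrightarrow> d y x < \<delta> \<Longrightarrow> dist (g y) (g x) < \<epsilon>"
      using \<epsilon> unfolding uniformly_continuous_map_def mm by fastforce
    have "r \<longlonglongrightarrow> 0"
      unfolding r_def using LIMSEQ_inverse_real_of_nat by (simp add: inverse_eq_divide)
    then have "\<forall>\<^sub>F k in sequentially. r k < \<delta>"
      using \<delta>(1) by (rule order_tendstoD)
    then show "\<forall>\<^sub>F k in sequentially. \<forall>y\<in>topspace X. \<forall>x\<in>F k. h k x y \<noteq> 0 \<longrightarrow> cmod (g x - g y) < \<epsilon>"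
    proof eventually_elim
      case (elim k)
      show ?case
      proof (intro ballI impI)
        fix y x assume "y \<in> topspace X" "x \<in> F k" "h k x y \<noteq> 0"
        then have "y \<in> M" "x \<in> M" "d x y < \<delta>"
          using F(2)[of k] top elim by (auto simp: h_def a_def)
        then show "cmod (g x - g y) < \<epsilon>"
          using \<delta>(2)[of y x] by (simp add: dist_norm)
      qed
    qed
  qed
  then show ?thesis by blast
qed

lemma net_partitionD:
  assumes "net_partition X F h"
  shows "finite (F k)" "x \<in> F k \<Longrightarrow> x \<in> topspace X"
    "x \<in> F k \<Longrightarrow> continuous_map X euclideanreal (h k x)" "0 \<le> h k x y"
    "y \<in> topspace X \<Longrightarrow> (\<Sum>x\<in>F k. h k x y) = 1"
  using assms by (auto simp: net_partition_def)

lemma net_partition_oscillation: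
  fixes g :: "'a \<Rightarrow> complex"
  assumes "net_partition X F h" "continuous_map X euclidean g" "\<epsilon> > 0"
  shows "\<forall>\<^sub>F k in sequentially. \<forall>y\<in>topspace X. \<forall>x\<in>F k. h k x y \<noteq> 0 \<longrightarrow> cmod (g x - g y) < \<epsilon>"
  using assms by (simp add: net_partition_def)

text \<open>The union of the nets is a countable dense set. This turns the supremum norm into a countable
  supremum, which is what makes it measurable in a parameter.\<close>

lemma sup_norm_eq_SUP_net:
  assumes net: "net_partition X F h" and g: "continuous_map X euclidean g"
  shows "sup_norm X g = (SUP x\<in>(\<Union>k. F k). ennreal (cmod (g x)))"
proof (rule antisym)
  show "(SUP x\<in>(\<Union>k. F k). ennreal (cmod (g x))) \<le> sup_norm X g"
    by (rule SUP_least) (use net_partitionD(2)[OF net] in \<open>blast intro: sup_norm_upper\<close>)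
  show "sup_norm X g \<le> (SUP x\<in>(\<Union>k. F k). ennreal (cmod (g x)))"
  proof (rule sup_norm_least, rule ennreal_le_epsilon)
    fix y and e :: real assume y: "y \<in> topspace X" and e: "0 < e"
    obtain k where k: "\<And>x. x \<in> F k \<Longrightarrow> h k x y \<noteq> 0 \<Longrightarrow> cmod (g x - g y) < e"
      using eventually_happens[OF net_partition_oscillation[OF net g e]] y by auto
    obtain x where x: "x \<in> F k" "h k x y \<noteq> 0"
      using net_partitionD(5)[OF net y, of k] by (metis sum.neutral zero_neq_one)
    have "cmod (g y) \<le> cmod (g x) + e"
      using k[OF x] norm_triangle_ineq2[of "g y" "g x"] by (simp add: norm_minus_commute)
    then have "ennreal (cmod (g y)) \<le> ennreal (cmod (g x)) + ennreal e"
      using e by (simp add: ennreal_leI flip: ennreal_plus)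
    also have "\<dots> \<le> (SUP x\<in>(\<Union>k. F k). ennreal (cmod (g x))) + ennreal e"
      using x(1) by (intro add_right_mono SUP_upper) blast
    finally show "ennreal (cmod (g y)) \<le> (SUP x\<in>(\<Union>k. F k). ennreal (cmod (g x))) + ennreal e" .
  qed
qed

lemma sup_norm_measurable:
  assumes net: "net_partition X F h"
    and cont: "\<And>\<sigma>. \<sigma> \<in> space M \<Longrightarrow> continuous_map X euclidean (g \<sigma>)"
    and meas: "\<And>x. x \<in> topspace X \<Longrightarrow> (\<lambda>\<sigma>. g \<sigma> x) \<in> borel_measurable M"
  shows "(\<lambda>\<sigma>. sup_norm X (g \<sigma>)) \<in> borel_measurable M"
proof -
  have count: "countable (\<Union>k. F k)"
    by (intro countable_UN countableI_type countable_finite net_partitionD(1)[OF net])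
  have [measurable]: "(\<lambda>\<sigma>. g \<sigma> x) \<in> borel_measurable M" if "x \<in> (\<Union>k. F k)" for x
    using that net_partitionD(2)[OF net] by (auto intro: meas)
  have "(\<lambda>\<sigma>. SUP x\<in>(\<Union>k. F k). ennreal (cmod (g \<sigma> x))) \<in> borel_measurable M"
    by (intro borel_measurable_SUP count) measurable
  moreover have "sup_norm X (g \<sigma>) = (SUP x\<in>(\<Union>k. F k). ennreal (cmod (g \<sigma> x)))" if "\<sigma> \<in> space M" for \<sigma>
    by (rule sup_norm_eq_SUP_net[OF net cont[OF that]])
  ultimately show ?thesis
    by (simp cong: measurable_cong)
qed

section \<open>Rounding complex numbers to a finite grid\<close>

text \<open>Truncation towards zero to multiples of \<open>1/n\<close>, so that absolute values do not increase.\<close>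

definition trunc_grid :: "nat \<Rightarrow> real \<Rightarrow> real" where
  "trunc_grid n x = of_int (if 0 \<le> x then \<lfloor>real n * x\<rfloor> else \<lceil>real n * x\<rceil>) / real n"

text \<open>Values beyond \<open>n\<close> are sent to zero to keep the range finite; for a bounded function this
  happens only for small \<open>n\<close>, so rounding still converges uniformly on it.\<close>

definition grid_round :: "nat \<Rightarrow> complex \<Rightarrow> complex" where
  "grid_round n z =
    (if cmod z \<le> real n then of_real (trunc_grid n (Re z)) + \<i> * of_real (trunc_grid n (Im z)) else 0)"

lemma abs_trunc_grid_le:
  assumes "n > 0" shows "\<bar>trunc_grid n x\<bar> \<le> \<bar>x\<bar>"
proof (cases "0 \<le> x")
  case True
  then have "0 \<le> \<lfloor>real n * x\<rfloor>" by simp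
  then show ?thesis
    using True assms of_int_floor_le[of "real n * x"] by (simp add: trunc_grid_def divide_le_eq mult.commute)
next
  case False
  then have "real n * x \<le> 0" by (simp add: mult_nonneg_nonpos)
  then have neg: "real_of_int \<lceil>real n * x\<rceil> \<le> 0" by (simp add: ceiling_le_iff)
  have "trunc_grid n x \<le> 0"
    using False neg by (simp add: trunc_grid_def divide_nonpos_nonneg)
  moreover have "x \<le> trunc_grid n x"
    using False assms le_of_int_ceiling[of "real n * x"]
    by (simp add: trunc_grid_def le_divide_eq mult.commute)
  ultimately show ?thesis by linarith
qed

lemma trunc_grid_close:
  assumes "n > 0" shows "\<bar>trunc_grid n x - x\<bar> \<le> 1 / real n"
proof -
  have "\<bar>real n * trunc_grid n x - real n * x\<bar> \<le> 1"
    using assms unfolding trunc_grid_def by (simp; linarith)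
  then have "real n * \<bar>trunc_grid n x - x\<bar> \<le> 1"
    by (simp add: abs_mult flip: right_diff_distrib)
  then show ?thesis using assms by (simp add: field_simps)
qed

lemma cmod_grid_round_le:
  assumes "n > 0" shows "cmod (grid_round n z) \<le> cmod z"
proof -
  have "(trunc_grid n (Re z))\<^sup>2 \<le> (Re z)\<^sup>2" "(trunc_grid n (Im z))\<^sup>2 \<le> (Im z)\<^sup>2"
    using abs_trunc_grid_le[OF assms] by (auto simp: abs_le_square_iff)
  then show ?thesis by (simp add: grid_round_def cmod_def)
qed

lemma grid_round_close:
  assumes "n > 0" "cmod z \<le> real n"
  shows "cmod (grid_round n z - z) \<le> 2 / real n"
proof -
  have "cmod (grid_round n z - z) \<le> \<bar>Re (grid_round n z - z)\<bar> + \<bar>Im (grid_round n z - z)\<bar>"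
    by (rule cmod_le)
  also have "\<dots> \<le> 1 / real n + 1 / real n"
    using assms trunc_grid_close[OF assms(1)] by (intro add_mono) (simp_all add: grid_round_def)
  finally show ?thesis by simp
qed

text \<open>Rounding towards zero keeps small values at zero, so simple functions built from rounded
  values are supported where the original function is bounded below.\<close>

lemma grid_round_nonzero:
  assumes "n > 0" "grid_round n z \<noteq> 0"
  shows "1 / real n \<le> cmod z"
proof (rule ccontr)
  assume "\<not> 1 / real n \<le> cmod z"
  then have *: "\<bar>Re z\<bar> < 1 / real n" "\<bar>Im z\<bar> < 1 / real n"
    using abs_Re_le_cmod[of z] abs_Im_le_cmod[of z] by linarith+
  have "trunc_grid n x = 0" if "\<bar>x\<bar> < 1 / real n" for x
  proof -
    have "\<bar>real n * x\<bar> < 1" using that assms(1) by (simp add: abs_mult field_simps)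
    moreover have "real n * x \<le> 0" if "\<not> 0 \<le> x"
      using that by (simp add: mult_nonneg_nonpos)
    ultimately show ?thesis
      by (auto simp: trunc_grid_def floor_eq_iff ceiling_eq_iff)
  qed
  with * assms(2) show False by (simp add: grid_round_def split: if_splits)
qed

lemma finite_range_grid_round:
  assumes "n > 0" shows "finite (range (grid_round n))"
proof (rule finite_subset)
  let ?B = "{- int (n * n)..int (n * n)}"
  let ?G = "(\<lambda>(a, b). of_real (of_int a / real n) + \<i> * of_real (of_int b / real n)) ` (?B \<times> ?B) :: complex set"
  show "finite (insert 0 ?G)" by simp
  have grid: "\<exists>a\<in>?B. trunc_grid n x = of_int a / real n" if "\<bar>x\<bar> \<le> real n" for x
  proof -
    define a where "a = (if 0 \<le> x then \<lfloor>real n * x\<rfloor> else \<lceil>real n * x\<rceil>)"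
    have a: "trunc_grid n x = of_int a / real n" by (simp add: a_def trunc_grid_def)
    have "\<bar>of_int a / real n\<bar> \<le> real n"
      using abs_trunc_grid_le[OF assms, of x] that unfolding a by linarith
    then have "\<bar>real_of_int a\<bar> \<le> real (n * n)"
      using assms by (simp add: divide_le_eq)
    then have "\<bar>a\<bar> \<le> int (n * n)" by linarith
    then show ?thesis using a by (intro bexI[of _ a]) auto
  qed
  show "range (grid_round n) \<subseteq> insert 0 ?G"
  proof (rule image_subsetI)
    fix z
    show "grid_round n z \<in> insert 0 ?G"
    proof (cases "cmod z \<le> real n")
      case True
      then have "\<bar>Re z\<bar> \<le> real n" "\<bar>Im z\<bar> \<le> real n"
        using abs_Re_le_cmod[of z] abs_Im_le_cmod[of z] by linarith+
      with grid obtain a b where "a \<in> ?B" "b \<in> ?B" "trunc_grid n (Re z) = of_int a / real n"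
        "trunc_grid n (Im z) = of_int b / real n" by meson
      with True show ?thesis by (auto simp: grid_round_def intro!: rev_image_eqI[of "(a, b)"])
    qed (simp add: grid_round_def)
  qed
qed

lemma borel_measurable_grid_round [measurable]: "grid_round n \<in> borel_measurable borel"
  unfolding grid_round_def trunc_grid_def by measurable

lemma simple_function_grid_round:
  assumes "n > 0" "f \<in> borel_measurable M"
  shows "simple_function M (\<lambda>\<sigma>. grid_round n (f \<sigma>))"
proof (rule simple_function_borel_measurable)
  show "(\<lambda>\<sigma>. grid_round n (f \<sigma>)) \<in> borel_measurable M" using assms(2) by measurable
  show "finite ((\<lambda>\<sigma>. grid_round n (f \<sigma>)) ` space M)"
    by (rule finite_subset[OF _ finite_range_grid_round[OF assms(1)]]) auto
qed

section \<open>Simple approximations of continuous functions\<close>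

definition net_interpolant ::
    "'a topology \<Rightarrow> (nat \<Rightarrow> 'a set) \<Rightarrow> (nat \<Rightarrow> 'a \<Rightarrow> 'a \<Rightarrow> real) \<Rightarrow> nat \<Rightarrow> ('a \<Rightarrow> complex) \<Rightarrow> 'a \<Rightarrow> complex"
  where "net_interpolant X F h k g =
    on_space X (\<lambda>y. \<Sum>x\<in>F k. grid_round (Suc k) (g x) * of_real (h k x y))"

lemma continuous_map_net_interpolant:
  assumes "net_partition X F h"
  shows "continuous_map X euclidean (net_interpolant X F h k g)"
  unfolding net_interpolant_def continuous_map_on_space
proof (rule continuous_map_sum)
  fix x assume "x \<in> F k"
  then have "continuous_map X euclideanreal (h k x)"
    by (rule net_partitionD(3)[OF assms])
  then show "continuous_map X euclidean (\<lambda>y. grid_round (Suc k) (g x) * complex_of_real (h k x y))"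
    by (auto simp: continuous_map_atin intro!: tendsto_mult tendsto_of_real)
qed (rule net_partitionD(1)[OF assms])

text \<open>Interpolation takes convex combinations of values that rounding does not enlarge.\<close>

lemma sup_norm_net_interpolant_le:
  assumes net: "net_partition X F h"
  shows "sup_norm X (net_interpolant X F h k g) \<le> sup_norm X g"
proof (cases "sup_norm X g" rule: ennreal_cases)
  case (real B)
  have gB: "cmod (g x) \<le> B" if "x \<in> topspace X" for x
    using sup_norm_upper[OF that, of g] real by simp
  show ?thesis
  proof (rule sup_norm_least)
    fix y assume y: "y \<in> topspace X"
    have "cmod (net_interpolant X F h k g y) \<le>
        (\<Sum>x\<in>F k. cmod (grid_round (Suc k) (g x) * of_real (h k x y)))"
      using y by (simp add: net_interpolant_def on_space_def norm_sum)
    also have "\<dots> \<le> (\<Sum>x\<in>F k. B * h k x y)"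
    proof (rule sum_mono)
      fix x assume x: "x \<in> F k"
      have "cmod (grid_round (Suc k) (g x)) \<le> B"
        using cmod_grid_round_le[of "Suc k" "g x"] gB[OF net_partitionD(2)[OF net x]] by simp
      then show "cmod (grid_round (Suc k) (g x) * of_real (h k x y)) \<le> B * h k x y"
        using net_partitionD(4)[OF net, of k x y] by (simp add: norm_mult mult_right_mono)
    qed
    also have "\<dots> = B"
      using net_partitionD(5)[OF net y, of k] by (simp flip: sum_distrib_left)
    finally show "ennreal (cmod (net_interpolant X F h k g y)) \<le> sup_norm X g"
      using real by (simp add: ennreal_leI)
  qed
qed simp

text \<open>At \<open>y\<close> only net points \<open>x\<close> with \<open>h k x y \<noteq> 0\<close> contribute; there the error splits into the
  oscillation of \<open>g\<close> and the rounding error, and convexity averages both.\<close>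

lemma sup_norm_net_interpolant_tendsto:
  assumes net: "net_partition X F h" and X: "compact_space X" and g: "continuous_map X euclidean g"
  shows "(\<lambda>k. sup_norm X (\<lambda>y. g y - net_interpolant X F h k g y)) \<longlonglongrightarrow> 0"
proof (rule tendsto_zero_ennreal)
  fix e :: real assume "0 < e"
  define e' where "e' = e / 2"
  have e: "0 < e'" "e' < e" using \<open>0 < e\<close> by (auto simp: e'_def)
  have "sup_norm X g \<noteq> top"
    using sup_norm_finite[OF X g] by simp
  then obtain B where B: "sup_norm X g = ennreal B" "0 \<le> B"
    by (cases "sup_norm X g" rule: ennreal_cases) auto
  have gB: "cmod (g x) \<le> B" if "x \<in> topspace X" for x
    using sup_norm_upper[OF that, of g] B by simp
  \<comment> \<open>Once \<open>Suc k\<close> exceeds the bound \<open>B\<close>, no value of \<open>g\<close> is cut off by the rounding.\<close>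
  have "\<forall>\<^sub>F k in sequentially. B \<le> real (Suc k)"
    by (meson eventually_sequentiallyI le_SucI of_nat_mono order_trans real_nat_ceiling_ge)
  moreover have "\<forall>\<^sub>F k in sequentially. 2 / real (Suc k) < e' / 2"
    by (rule order_tendstoD(2)[OF LIMSEQ_Suc[OF lim_const_over_n[of "2 :: real"]]]) (use e in simp)
  moreover have "\<forall>\<^sub>F k in sequentially. \<forall>y\<in>topspace X. \<forall>x\<in>F k. h k x y \<noteq> 0 \<longrightarrow> cmod (g x - g y) < e' / 2"
    using e by (intro net_partition_oscillation[OF net g]) simp
  ultimately show "\<forall>\<^sub>F k in sequentially. sup_norm X (\<lambda>y. g y - net_interpolant X F h k g y) < ennreal e"
  proof eventually_elim
    case (elim k)
    have "sup_norm X (\<lambda>y. g y - net_interpolant X F h k g y) \<le> ennreal e'"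
    proof (rule sup_norm_least, rule ennreal_leI)
      fix y assume y: "y \<in> topspace X"
      let ?r = "\<lambda>x. grid_round (Suc k) (g x)"
      have "g y = (\<Sum>x\<in>F k. g y * of_real (h k x y))"
        using net_partitionD(5)[OF net y, of k] by (simp flip: sum_distrib_left of_real_sum)
      then have "g y - net_interpolant X F h k g y = (\<Sum>x\<in>F k. (g y - ?r x) * of_real (h k x y))"
        using y by (simp add: net_interpolant_def on_space_def left_diff_distrib sum_subtractf)
      also have "cmod \<dots> \<le> (\<Sum>x\<in>F k. cmod ((g y - ?r x) * of_real (h k x y)))"
        by (rule norm_sum)
      also have "\<dots> \<le> (\<Sum>x\<in>F k. e' * h k x y)"
      proof (rule sum_mono)
        fix x assume x: "x \<in> F k"
        show "cmod ((g y - ?r x) * of_real (h k x y)) \<le> e' * h k x y"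
        proof (cases "h k x y = 0")
          case False
          have "cmod (g x) \<le> real (Suc k)"
            using gB[OF net_partitionD(2)[OF net x]] elim(1) by linarith
          then have "cmod (?r x - g x) \<le> 2 / real (Suc k)"
            by (intro grid_round_close) auto
          moreover have "cmod (g x - g y) < e' / 2"
            using elim(3) y x False by blast
          moreover have "cmod (g y - ?r x) \<le> cmod (g x - g y) + cmod (?r x - g x)"
            using norm_triangle_ineq[of "g x - g y" "?r x - g x"] by (simp add: norm_minus_commute)
          ultimately have "cmod (g y - ?r x) \<le> e'"
            using elim(2) by linarith
          then show ?thesis
            using net_partitionD(4)[OF net, of k x y] by (simp add: norm_mult mult_right_mono)
        qed simp
      qed
      also have "\<dots> = e'"
        using net_partitionD(5)[OF net y, of k] by (simp flip: sum_distrib_left)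
      finally show "cmod (g y - net_interpolant X F h k g y) \<le> e'" .
    qed
    also have "\<dots> < ennreal e" using e by (simp add: ennreal_less_iff)
    finally show ?case .
  qed
qed

lemma net_interpolant_nonzero:
  assumes net: "net_partition X F h" and nz: "net_interpolant X F h k g y \<noteq> 0"
  shows "ennreal (1 / real (Suc k)) \<le> sup_norm X g"
proof -
  have "\<exists>x\<in>F k. grid_round (Suc k) (g x) * of_real (h k x y) \<noteq> 0"
    using nz sum.neutral[of "F k" "\<lambda>x. grid_round (Suc k) (g x) * of_real (h k x y)"]
    by (auto simp: net_interpolant_def on_space_def split: if_splits)
  then obtain x where x: "x \<in> F k" "grid_round (Suc k) (g x) \<noteq> 0" by auto
  have "ennreal (1 / real (Suc k)) \<le> ennreal (cmod (g x))"
    using x(2) by (intro ennreal_leI grid_round_nonzero) auto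
  also have "\<dots> \<le> sup_norm X g"
    by (rule sup_norm_upper[OF net_partitionD(2)[OF net x(1)]])
  finally show ?thesis .
qed

lemma sum_fun_apply: "(\<Sum>x\<in>A. u x) y = (\<Sum>x\<in>A. u x y)"
  by (induction A rule: infinite_finite_induct) auto

lemma simple_function_net_interpolant:
  assumes net: "net_partition X F h"
    and meas: "\<And>x. x \<in> topspace X \<Longrightarrow> (\<lambda>\<sigma>. g \<sigma> x) \<in> borel_measurable M"
  shows "simple_function M (\<lambda>\<sigma>. net_interpolant X F h k (g \<sigma>))"
proof -
  have "simple_function M (\<lambda>\<sigma>. \<Sum>x\<in>F k. (\<lambda>y. grid_round (Suc k) (g \<sigma> x) * of_real (h k x y)))"
  proof (rule simple_function_sum)
    fix x assume "x \<in> F k"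
    then have "simple_function M (\<lambda>\<sigma>. grid_round (Suc k) (g \<sigma> x))"
      by (intro simple_function_grid_round meas net_partitionD(2)[OF net]) auto
    then show "simple_function M (\<lambda>\<sigma>. (\<lambda>y. grid_round (Suc k) (g \<sigma> x) * of_real (h k x y)))"
      by (rule simple_function_compose1)
  qed
  then have "simple_function M (\<lambda>\<sigma>. on_space X (\<Sum>x\<in>F k. (\<lambda>y. grid_round (Suc k) (g \<sigma> x) * of_real (h k x y))))"
    by (rule simple_function_compose1)
  then show ?thesis
    unfolding net_interpolant_def on_space_def sum_fun_apply .
qed

lemma simple_function_tensor:
  assumes "\<And>i. i \<in> {1..m} \<Longrightarrow> simple_function M (u i)"
  shows "simple_function M (\<lambda>\<sigma>. tensor m X (\<lambda>i. u i \<sigma>))"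
proof -
  have "simple_function M (\<lambda>\<sigma>. (\<lambda>\<omega>. \<Prod>i=1..n. u i \<sigma> (\<omega> i)))" if "n \<le> m" for n
    using that
  proof (induction n)
    case (Suc n)
    then have "simple_function M (\<lambda>\<sigma>. (\<lambda>p v. (\<lambda>\<omega>. p \<omega> * v (\<omega> (Suc n)))) (\<lambda>\<omega>. \<Prod>i=1..n. u i \<sigma> (\<omega> i)) (u (Suc n) \<sigma>))"
      by (intro simple_function_compose2[where h="\<lambda>p v. (\<lambda>\<omega>. p \<omega> * v (\<omega> (Suc n)))"] assms) auto
    then show ?case by simp
  qed simp
  then show ?thesis
    unfolding tensor_def by (intro simple_function_compose1[where g="on_space (prod_space m X)"]) auto
qed

section \<open>Integration of functions with values in the Varopoulos algebra\<close>

lemma simple_bochner_integral_apply: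
  assumes "Bochner_Integration.simple_bochner_integrable M u"
  shows "Bochner_Integration.simple_bochner_integral M u \<omega> = (LINT \<sigma>|M. u \<sigma> (\<omega> :: 'b) :: complex)"
    and "integrable M (\<lambda>\<sigma>. u \<sigma> \<omega>)"
proof -
  have "linear (\<lambda>g :: 'b \<Rightarrow> complex. g \<omega>)"
    by (rule linearI) (auto simp: scaleR_fun_def)
  then have "Bochner_Integration.simple_bochner_integral M u \<omega> = Bochner_Integration.simple_bochner_integral M (\<lambda>\<sigma>. u \<sigma> \<omega>)"
    using simple_bochner_integral_linear[OF _ assms, of "\<lambda>g. g \<omega>"] by simp
  moreover have u: "Bochner_Integration.simple_bochner_integrable M (\<lambda>\<sigma>. u \<sigma> \<omega>)"
    using simple_bochner_integrable_compose2[where p="\<lambda>g _. g \<omega>", OF _ assms assms] by simp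
  ultimately show "Bochner_Integration.simple_bochner_integral M u \<omega> = (LINT \<sigma>|M. u \<sigma> \<omega>)"
    using simple_bochner_integrable_eq_integral[OF u] by simp
  show "integrable M (\<lambda>\<sigma>. u \<sigma> \<omega>)"
    using has_bochner_integral_simple_bochner_integrable[OF u] by (rule integrable.intros)
qed

text \<open>The triangle inequality for the finite sum that defines the integral of a simple function.\<close>

lemma varopoulos_norm_simple_bochner_integral:
  assumes m: "m \<ge> 1" and u: "simple_function M u"
  shows "varopoulos_norm m X (Bochner_Integration.simple_bochner_integral M u) \<le> (\<integral>\<^sup>+\<sigma>. varopoulos_norm m X (u \<sigma>) \<partial>M)"
proof -
  let ?A = "\<lambda>y. {\<sigma>\<in>space M. u \<sigma> = y}"
  have fin: "finite (u ` space M)"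
    using u by (rule simple_functionD)
  have A: "?A y \<in> sets M" for y
    using simple_functionD(2)[OF u, of "{y}"] by (simp add: vimage_def Int_def conj_commute)
  have measure_le: "ennreal (measure M B) \<le> emeasure M B" for B
    by (cases "emeasure M B = top") (auto simp: measure_def ennreal_enn2real_if)
  have eq: "Bochner_Integration.simple_bochner_integral M u = (\<lambda>\<omega>. \<Sum>y\<in>u ` space M. of_real (measure M (?A y)) * y \<omega>)"
    by (rule ext) (simp add: simple_bochner_integral_def sum_fun_apply scaleR_fun_def scaleR_conv_of_real)
  have "varopoulos_norm m X (Bochner_Integration.simple_bochner_integral M u) \<le>
      (\<Sum>y\<in>u ` space M. varopoulos_norm m X (\<lambda>\<omega>. of_real (measure M (?A y)) * y \<omega>))"
    unfolding eq using m fin by (rule varopoulos_norm_sum)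
  also have "\<dots> \<le> (\<Sum>y\<in>u ` space M. varopoulos_norm m X y * emeasure M (?A y))"
  proof (rule sum_mono)
    fix y
    have "varopoulos_norm m X (\<lambda>\<omega>. of_real (measure M (?A y)) * y \<omega>) \<le>
        ennreal (measure M (?A y)) * varopoulos_norm m X y"
      using varopoulos_norm_scale[OF m, of X "of_real (measure M (?A y))" y] by simp
    also have "\<dots> \<le> varopoulos_norm m X y * emeasure M (?A y)"
      by (subst mult.commute) (intro mult_left_mono measure_le, simp)
    finally show "varopoulos_norm m X (\<lambda>\<omega>. of_real (measure M (?A y)) * y \<omega>) \<le>
        varopoulos_norm m X y * emeasure M (?A y)" .
  qed
  also have "\<dots> = (\<integral>\<^sup>+\<sigma>. (\<Sum>y\<in>u ` space M. varopoulos_norm m X y * indicator (?A y) \<sigma>) \<partial>M)"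
    using A by (simp add: nn_integral_sum nn_integral_cmult_indicator)
  also have "\<dots> = (\<integral>\<^sup>+\<sigma>. varopoulos_norm m X (u \<sigma>) \<partial>M)"
  proof (rule nn_integral_cong)
    fix \<sigma> assume \<sigma>: "\<sigma> \<in> space M"
    have "(\<Sum>y\<in>u ` space M. varopoulos_norm m X y * indicator (?A y) \<sigma>) =
        (\<Sum>y\<in>u ` space M. if u \<sigma> = y then varopoulos_norm m X y else 0)"
      using \<sigma> by (intro sum.cong) (auto simp: indicator_def)
    also have "\<dots> = varopoulos_norm m X (u \<sigma>)"
      using \<sigma> fin by simp
    finally show "(\<Sum>y\<in>u ` space M. varopoulos_norm m X y * indicator (?A y) \<sigma>) =
        varopoulos_norm m X (u \<sigma>)" .
  qed
  finally show ?thesis .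
qed

text \<open>A function with values in the algebra is Bochner integrable, with the pointwise integral as its
  Bochner integral, once it is approximated by simple functions with measurable error bounds
  \<open>E k\<close> whose integrals tend to zero. The common majorant \<open>G\<close> yields the norm estimate.\<close>

lemma varopoulos_bochner_integral:
  fixes f :: "'s \<Rightarrow> (nat \<Rightarrow> 'a) \<Rightarrow> complex" and s :: "nat \<Rightarrow> 's \<Rightarrow> (nat \<Rightarrow> 'a) \<Rightarrow> complex"
  assumes m: "m \<ge> 1"
    and f: "\<And>\<sigma>. \<sigma> \<in> space M \<Longrightarrow> f \<sigma> \<in> varopoulos m X"
    and f_meas: "\<And>\<omega>. \<omega> \<in> topspace (prod_space m X) \<Longrightarrow> (\<lambda>\<sigma>. f \<sigma> \<omega>) \<in> borel_measurable M"
    and s_int: "\<And>k. Bochner_Integration.simple_bochner_integrable M (s k)"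
    and s: "\<And>k \<sigma>. \<sigma> \<in> space M \<Longrightarrow> s k \<sigma> \<in> varopoulos m X"
    and E_meas: "\<And>k. E k \<in> borel_measurable M"
    and E: "\<And>k \<sigma>. \<sigma> \<in> space M \<Longrightarrow> varopoulos_norm m X (\<lambda>\<omega>. f \<sigma> \<omega> - s k \<sigma> \<omega>) \<le> E k \<sigma>"
    and E_lim: "\<And>\<sigma>. \<sigma> \<in> space M \<Longrightarrow> (\<lambda>k. E k \<sigma>) \<longlonglongrightarrow> 0"
    and E_int: "(\<lambda>k. \<integral>\<^sup>+\<sigma>. E k \<sigma> \<partial>M) \<longlonglongrightarrow> 0"
    and f_G: "\<And>\<sigma>. \<sigma> \<in> space M \<Longrightarrow> varopoulos_norm m X (f \<sigma>) \<le> G \<sigma>"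
    and s_G: "\<And>k \<sigma>. \<sigma> \<in> space M \<Longrightarrow> varopoulos_norm m X (s k \<sigma>) \<le> G \<sigma>"
    and G: "(\<integral>\<^sup>+\<sigma>. G \<sigma> \<partial>M) < \<infinity>"
    and \<Phi>: "\<Phi> = on_space (prod_space m X) (\<lambda>\<omega>. LINT \<sigma>|M. f \<sigma> \<omega>)"
  shows "has_bochner_integral_in (varopoulos m X) (varopoulos_norm m X) M f \<Phi>"
    and "varopoulos_norm m X \<Phi> \<le> (\<integral>\<^sup>+\<sigma>. G \<sigma> \<partial>M)"
proof -
  let ?N = "varopoulos_norm m X" and ?\<Omega> = "topspace (prod_space m X)"
  \<comment> \<open>Pass to a subsequence along which the errors are summable.\<close>
  have "\<exists>k\<ge>n. (\<integral>\<^sup>+\<sigma>. E k \<sigma> \<partial>M) < ennreal ((1/2) ^ n)" for n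
  proof -
    have "\<forall>\<^sub>F k in sequentially. (\<integral>\<^sup>+\<sigma>. E k \<sigma> \<partial>M) < ennreal ((1/2) ^ n)"
      by (rule order_tendstoD(2)[OF E_int]) simp
    then show ?thesis
      using eventually_happens[OF eventually_conj[OF eventually_ge_at_top[of n]]] by auto
  qed
  then obtain r where r: "\<And>n. n \<le> r n" "\<And>n. (\<integral>\<^sup>+\<sigma>. E (r n) \<sigma> \<partial>M) < ennreal ((1/2) ^ n)"
    by metis
  have r_top: "filterlim r at_top sequentially"
    by (rule filterlim_at_top_mono[OF filterlim_ident]) (simp add: r(1))
  define I where "I n = Bochner_Integration.simple_bochner_integral M (s (r n))" for n
  have I_apply: "I n \<omega> = (LINT \<sigma>|M. s (r n) \<sigma> \<omega>)" for n \<omega>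
    unfolding I_def by (rule simple_bochner_integral_apply(1)[OF s_int])
  have E_int': "(\<lambda>n. \<integral>\<^sup>+\<sigma>. E (r n) \<sigma> \<partial>M) \<longlonglongrightarrow> 0"
    using E_int r_top by (rule filterlim_compose)

  have I_lim: "(\<lambda>n. I n \<omega>) \<longlonglongrightarrow> \<Phi> \<omega>" if \<omega>: "\<omega> \<in> ?\<Omega>" for \<omega>
  proof -
    have "(\<integral>\<^sup>+\<sigma>. ennreal (cmod (f \<sigma> \<omega>)) \<partial>M) \<le> (\<integral>\<^sup>+\<sigma>. G \<sigma> \<partial>M)"
      by (intro nn_integral_mono order_trans[OF varopoulos_norm_upper[OF \<omega>] f_G])
    then have f_int: "integrable M (\<lambda>\<sigma>. f \<sigma> \<omega>)"
      using G by (intro integrableI_bounded f_meas[OF \<omega>]) (simp add: le_less_trans)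
    have "(\<lambda>n. LINT \<sigma>|M. s (r n) \<sigma> \<omega>) \<longlonglongrightarrow> (LINT \<sigma>|M. f \<sigma> \<omega>)"
    proof (rule tendsto_L1_int)
      show "integrable M (\<lambda>\<sigma>. s (r n) \<sigma> \<omega>)" for n
        by (rule simple_bochner_integral_apply(2)[OF s_int])
      show "(\<lambda>n. \<integral>\<^sup>+\<sigma>. ennreal (cmod (s (r n) \<sigma> \<omega> - f \<sigma> \<omega>)) \<partial>M) \<longlonglongrightarrow> 0"
      proof (rule tendsto_sandwich[OF _ _ tendsto_const E_int'])
        have "ennreal (cmod (s (r n) \<sigma> \<omega> - f \<sigma> \<omega>)) \<le> E (r n) \<sigma>" if "\<sigma> \<in> space M" for n \<sigma>
          using order_trans[OF varopoulos_norm_upper[OF \<omega>] E[OF that, of "r n"]]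
          by (simp add: norm_minus_commute)
        then show "\<forall>\<^sub>F n in sequentially.
            (\<integral>\<^sup>+\<sigma>. ennreal (cmod (s (r n) \<sigma> \<omega> - f \<sigma> \<omega>)) \<partial>M) \<le> (\<integral>\<^sup>+\<sigma>. E (r n) \<sigma> \<partial>M)"
          by (intro always_eventually allI nn_integral_mono)
      qed simp
    qed (rule f_int)
    then show ?thesis
      using \<omega> by (simp add: I_apply \<Phi> on_space_def)
  qed

  have I_step: "?N (\<lambda>\<omega>. I n \<omega> - I (Suc n) \<omega>) \<le> ennreal (2 * (1/2) ^ n)" for n
  proof -
    let ?u = "\<lambda>\<sigma>. s (r n) \<sigma> - s (r (Suc n)) \<sigma>"
    have simp_u: "simple_function M ?u"
      using s_int by (intro simple_function_diff) (auto simp: simple_bochner_integrable.simps)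
    have "(\<lambda>\<omega>. I n \<omega> - I (Suc n) \<omega>) = Bochner_Integration.simple_bochner_integral M ?u"
      unfolding I_def simple_bochner_integral_diff[OF s_int s_int] by (simp add: fun_diff_def)
    then have "?N (\<lambda>\<omega>. I n \<omega> - I (Suc n) \<omega>) \<le> (\<integral>\<^sup>+\<sigma>. ?N (?u \<sigma>) \<partial>M)"
      using varopoulos_norm_simple_bochner_integral[OF m simp_u] by simp
    also have "\<dots> \<le> (\<integral>\<^sup>+\<sigma>. E (r (Suc n)) \<sigma> + E (r n) \<sigma> \<partial>M)"
    proof (rule nn_integral_mono)
      fix \<sigma> assume \<sigma>: "\<sigma> \<in> space M"
      have "?u \<sigma> = (\<lambda>\<omega>. (f \<sigma> \<omega> - s (r (Suc n)) \<sigma> \<omega>) - (f \<sigma> \<omega> - s (r n) \<sigma> \<omega>))"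
        by (simp add: fun_diff_def)
      then have "?N (?u \<sigma>) \<le>
          ?N (\<lambda>\<omega>. f \<sigma> \<omega> - s (r (Suc n)) \<sigma> \<omega>) + ?N (\<lambda>\<omega>. f \<sigma> \<omega> - s (r n) \<sigma> \<omega>)"
        by (simp only: varopoulos_norm_diff[OF m])
      also have "\<dots> \<le> E (r (Suc n)) \<sigma> + E (r n) \<sigma>"
        by (intro add_mono E \<sigma>)
      finally show "?N (?u \<sigma>) \<le> E (r (Suc n)) \<sigma> + E (r n) \<sigma>" .
    qed
    also have "\<dots> = (\<integral>\<^sup>+\<sigma>. E (r (Suc n)) \<sigma> \<partial>M) + (\<integral>\<^sup>+\<sigma>. E (r n) \<sigma> \<partial>M)"
      by (intro nn_integral_add E_meas)
    also have "\<dots> \<le> ennreal ((1/2) ^ Suc n) + ennreal ((1/2) ^ n)"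
      by (intro add_mono less_imp_le r)
    also have "\<dots> \<le> ennreal (2 * (1/2) ^ n)"
      by (simp add: ennreal_leI flip: ennreal_plus)
    finally show ?thesis .
  qed

  \<comment> \<open>The integrals converge to \<open>\<Phi>\<close> pointwise and their steps are summable in norm, so
    countable subadditivity applied to the telescoping series bounds the error in norm.\<close>
  have I_tail: "?N (\<lambda>\<omega>. I n \<omega> - \<Phi> \<omega>) \<le> ennreal (4 * (1/2) ^ n)" for n
  proof -
    have "?N (\<lambda>\<omega>. I n \<omega> - \<Phi> \<omega>) \<le> (\<Sum>j. ?N (\<lambda>\<omega>. I (j + n) \<omega> - I (Suc (j + n)) \<omega>))"
    proof (rule varopoulos_norm_suminf)
      fix \<omega> assume "\<omega> \<in> ?\<Omega>"
      then have "(\<lambda>j. I (j + n) \<omega>) \<longlonglongrightarrow> \<Phi> \<omega>"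
        using LIMSEQ_ignore_initial_segment[OF I_lim] by blast
      then show "(\<lambda>j. I (j + n) \<omega> - I (Suc (j + n)) \<omega>) sums (I n \<omega> - \<Phi> \<omega>)"
        using telescope_sums'[of "\<lambda>j. I (j + n) \<omega>"] by simp
    qed
    also have "\<dots> \<le> (\<Sum>j. ennreal (2 * (1/2) ^ (j + n)))"
      by (intro suminf_le I_step) auto
    also have "\<dots> = ennreal (4 * (1/2) ^ n)"
    proof (rule suminf_ennreal_eq)
      have "(\<lambda>j. 2 * (1/2) ^ n * (1/2 :: real) ^ j) sums (2 * (1/2) ^ n * (1 / (1 - 1/2)))"
        by (intro sums_mult geometric_sums) simp
      then show "(\<lambda>j. 2 * (1/2 :: real) ^ (j + n)) sums (4 * (1/2) ^ n)"
        by (simp add: power_add mult_ac)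
    qed simp
    finally show ?thesis .
  qed
  have tail_lim: "(\<lambda>n. ennreal (4 * (1/2) ^ n)) \<longlonglongrightarrow> 0"
  proof -
    have "(\<lambda>n. 4 * (1/2 :: real) ^ n) \<longlonglongrightarrow> 4 * 0"
      by (intro tendsto_mult tendsto_const LIMSEQ_realpow_zero) auto
    from tendsto_ennrealI[OF this] show ?thesis by simp
  qed

  have I_G: "?N (I n) \<le> (\<integral>\<^sup>+\<sigma>. G \<sigma> \<partial>M)" for n
  proof -
    have "?N (I n) \<le> (\<integral>\<^sup>+\<sigma>. ?N (s (r n) \<sigma>) \<partial>M)"
      unfolding I_def using s_int[of "r n"]
      by (intro varopoulos_norm_simple_bochner_integral m) (auto simp: simple_bochner_integrable.simps)
    also have "\<dots> \<le> (\<integral>\<^sup>+\<sigma>. G \<sigma> \<partial>M)"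
      by (intro nn_integral_mono s_G)
    finally show ?thesis .
  qed
  have "?N \<Phi> \<le> (\<integral>\<^sup>+\<sigma>. G \<sigma> \<partial>M) + ennreal (4 * (1/2) ^ n)" for n
  proof -
    have "?N \<Phi> = ?N (\<lambda>\<omega>. I n \<omega> - (I n \<omega> - \<Phi> \<omega>))" by simp
    also have "\<dots> \<le> ?N (I n) + ?N (\<lambda>\<omega>. I n \<omega> - \<Phi> \<omega>)"
      by (rule varopoulos_norm_diff[OF m])
    also have "\<dots> \<le> (\<integral>\<^sup>+\<sigma>. G \<sigma> \<partial>M) + ennreal (4 * (1/2) ^ n)"
      by (intro add_mono I_G I_tail)
    finally show ?thesis .
  qed
  moreover have "(\<lambda>n. (\<integral>\<^sup>+\<sigma>. G \<sigma> \<partial>M) + ennreal (4 * (1/2) ^ n)) \<longlonglongrightarrow> (\<integral>\<^sup>+\<sigma>. G \<sigma> \<partial>M) + 0"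
    by (intro tendsto_add tendsto_const tail_lim)
  ultimately show bound: "?N \<Phi> \<le> (\<integral>\<^sup>+\<sigma>. G \<sigma> \<partial>M)"
    by (intro LIMSEQ_le_const[where X="\<lambda>n. (\<integral>\<^sup>+\<sigma>. G \<sigma> \<partial>M) + ennreal (4 * (1/2) ^ n)"]) auto

  have "\<Phi> \<in> varopoulos m X"
    unfolding varopoulos_iff using le_less_trans[OF bound G] by (simp add: \<Phi> on_space_def)
  moreover have "strongly_measurable_in (varopoulos m X) ?N M f"
    unfolding strongly_measurable_in_def
  proof (intro conjI exI[of _ s] allI ballI)
    show "f ` space M \<subseteq> varopoulos m X" "s k ` space M \<subseteq> varopoulos m X" for k
      using f s by auto
    show "simple_function M (s k)" for k
      using s_int by (auto simp: simple_bochner_integrable.simps)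
    show "(\<lambda>k. ?N (f \<sigma> - s k \<sigma>)) \<longlonglongrightarrow> 0" if "\<sigma> \<in> space M" for \<sigma>
      by (rule tendsto_sandwich[OF _ _ tendsto_const E_lim[OF that]])
         (use E[OF that] in \<open>auto simp: fun_diff_def\<close>)
  qed
  moreover have "(\<lambda>n. \<integral>\<^sup>+\<sigma>. ?N (f \<sigma> - s (r n) \<sigma>) \<partial>M) \<longlonglongrightarrow> 0"
    by (rule tendsto_sandwich[OF _ _ tendsto_const E_int'])
       (auto simp: fun_diff_def intro!: always_eventually nn_integral_mono E)
  moreover have "(\<lambda>n. ?N (Bochner_Integration.simple_bochner_integral M (s (r n)) - \<Phi>)) \<longlonglongrightarrow> 0"
    by (rule tendsto_sandwich[OF _ _ tendsto_const tail_lim])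
       (use I_tail in \<open>auto simp: fun_diff_def I_def\<close>)
  ultimately show "has_bochner_integral_in (varopoulos m X) ?N M f \<Phi>"
    unfolding has_bochner_integral_in_def
    using s s_int by (intro conjI exI[of _ "\<lambda>n. s (r n)"]) auto
qed

section \<open>The integral of a product of continuous functions\<close>

lemma borel_measurable_section:
  assumes "f \<in> borel_measurable (borel_of X \<Otimes>\<^sub>M M)" "x \<in> topspace X"
  shows "(\<lambda>\<sigma>. f (x, \<sigma>)) \<in> borel_measurable M"
proof (rule measurable_compose[OF _ assms(1)])
  have "space (borel_of X) = topspace X"
    unfolding borel_of_def by (rule space_measure_of) (auto dest: openin_subset)
  then show "(\<lambda>\<sigma>. (x, \<sigma>)) \<in> M \<rightarrow>\<^sub>M borel_of X \<Otimes>\<^sub>M M"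
    using assms(2) by (intro measurable_Pair measurable_const measurable_ident_sets) auto
qed

lemma ennreal_prod_less_top:
  fixes f :: "'i \<Rightarrow> ennreal"
  shows "(\<And>i. i \<in> A \<Longrightarrow> f i < top) \<Longrightarrow> prod f A < top"
  by (induction A rule: infinite_finite_induct) (auto simp: ennreal_mult_less_top)

theorem theorem2p7:
  fixes m :: nat
    and X :: "nat \<Rightarrow> 'a topology"
    and M :: "'s measure"
    and \<phi> :: "nat \<Rightarrow> 'a \<times> 's \<Rightarrow> complex"
    and \<Phi> :: "(nat \<Rightarrow> 'a) \<Rightarrow> complex"
  assumes "m \<ge> 1"
    and "\<And>i. i \<in> {1..m} \<Longrightarrow> compact_space (X i)"
    and "\<And>i. i \<in> {1..m} \<Longrightarrow> Hausdorff_space (X i)"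
    and "\<And>i. i \<in> {1..m} \<Longrightarrow> metrizable_space (X i)"
    and "\<And>i. i \<in> {1..m} \<Longrightarrow> \<phi> i \<in> borel_measurable (borel_of (X i) \<Otimes>\<^sub>M M)"
    and "\<And>i \<sigma>. i \<in> {1..m} \<Longrightarrow> \<sigma> \<in> space M \<Longrightarrow>
           continuous_map (X i) euclidean (\<lambda>\<omega>. \<phi> i (\<omega>, \<sigma>))"
    and "(\<integral>\<^sup>+\<sigma>. (\<Prod>i=1..m. sup_norm (X i) (\<lambda>\<omega>. \<phi> i (\<omega>, \<sigma>))) \<partial>M) < \<infinity>"
    and "\<Phi> = on_space (prod_space m X) (\<lambda>\<omega>. LINT \<sigma>|M. (\<Prod>i=1..m. \<phi> i (\<omega> i, \<sigma>)))"
  shows "has_bochner_integral_in (varopoulos m X) (varopoulos_norm m X) M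
           (\<lambda>\<sigma>. tensor m X (\<lambda>i \<omega>. \<phi> i (\<omega>, \<sigma>))) \<Phi>
       \<and> \<Phi> \<in> varopoulos m X
       \<and> varopoulos_norm m X \<Phi> \<le>
           (\<integral>\<^sup>+\<sigma>. (\<Prod>i=1..m. sup_norm (X i) (\<lambda>\<omega>. \<phi> i (\<omega>, \<sigma>))) \<partial>M)"
proof -
  note m = assms(1) and cpt = assms(2) and cont = assms(6) and \<Phi> = assms(8)
  let ?N = "varopoulos_norm m X"
  define g where "g i \<sigma> = (\<lambda>\<omega>. \<phi> i (\<omega>, \<sigma>))" for i \<sigma>
  have "\<exists>F h. net_partition (X i) F h" if "i \<in> {1..m}" for i
    using assms(2,4)[OF that] by (rule net_partition_exists)
  then obtain F h where net: "\<And>i. i \<in> {1..m} \<Longrightarrow> net_partition (X i) (F i) (h i)"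
    by metis
  define S where "S k i \<sigma> = net_interpolant (X i) (F i) (h i) k (g i \<sigma>)" for k i \<sigma>
  have g_cont: "continuous_map (X i) euclidean (g i \<sigma>)" if "i \<in> {1..m}" "\<sigma> \<in> space M" for i \<sigma>
    unfolding g_def by (rule cont[OF that])
  have g_meas: "(\<lambda>\<sigma>. g i \<sigma> x) \<in> borel_measurable M" if "i \<in> {1..m}" "x \<in> topspace (X i)" for i x
    unfolding g_def by (rule borel_measurable_section[OF assms(5)[OF that(1)] that(2)])
  have S_cont: "continuous_map (X i) euclidean (S k i \<sigma>)" if "i \<in> {1..m}" for k i \<sigma>
    unfolding S_def by (rule continuous_map_net_interpolant[OF net[OF that]])
  have S_le: "sup_norm (X i) (S k i \<sigma>) \<le> sup_norm (X i) (g i \<sigma>)" if "i \<in> {1..m}" for k i \<sigma>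
    unfolding S_def by (rule sup_norm_net_interpolant_le[OF net[OF that]])
  have S_simple: "simple_function M (S k i)" if "i \<in> {1..m}" for k i
    unfolding S_def by (rule simple_function_net_interpolant[OF net[OF that] g_meas[OF that]])
  have S_meas: "(\<lambda>\<sigma>. S k i \<sigma> x) \<in> borel_measurable M" if "i \<in> {1..m}" for k i x
    using simple_function_compose1[OF S_simple[OF that], of "\<lambda>u. u x"]
    by (rule borel_measurable_simple_function)

  define f where "f \<sigma> = tensor m X (\<lambda>i. g i \<sigma>)" for \<sigma>
  define s where "s k \<sigma> = tensor m X (\<lambda>i. S k i \<sigma>)" for k \<sigma>
  define G where "G \<sigma> = (\<Prod>i=1..m. sup_norm (X i) (g i \<sigma>))" for \<sigma>
  \<comment> \<open>\<open>E k \<sigma>\<close> is the telescoping bound for \<open>N (f \<sigma> - s k \<sigma>)\<close>: the error \<open>D\<close> in one factor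
    times the norms \<open>R\<close> of the others.\<close>
  define D where "D k j \<sigma> = sup_norm (X j) (\<lambda>x. g j \<sigma> x - S k j \<sigma> x)" for k j \<sigma>
  define R where "R j \<sigma> = (\<Prod>i\<in>{1..m}-{j}. sup_norm (X i) (g i \<sigma>))" for j \<sigma>
  define E where "E k \<sigma> = (\<Sum>j=1..m. D k j \<sigma> * R j \<sigma>)" for k \<sigma>
  have G_split: "G \<sigma> = sup_norm (X j) (g j \<sigma>) * R j \<sigma>" if "j \<in> {1..m}" for j \<sigma>
    unfolding G_def R_def using that by (intro prod.remove) auto
  have g_fin: "sup_norm (X i) (g i \<sigma>) < \<infinity>" if "i \<in> {1..m}" "\<sigma> \<in> space M" for i \<sigma>
    by (rule sup_norm_finite[OF cpt[OF that(1)] g_cont[OF that]])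
  have R_fin: "R j \<sigma> < \<infinity>" if "\<sigma> \<in> space M" for j \<sigma>
    unfolding R_def infinity_ennreal_def using g_fin[OF _ that] by (intro ennreal_prod_less_top) auto
  have g_norm_meas: "(\<lambda>\<sigma>. sup_norm (X i) (g i \<sigma>)) \<in> borel_measurable M" if "i \<in> {1..m}" for i
    by (rule sup_norm_measurable[OF net[OF that] g_cont[OF that] g_meas[OF that]])
  have D_meas: "D k j \<in> borel_measurable M" if "j \<in> {1..m}" for k j
    unfolding D_def
    by (rule sup_norm_measurable[OF net[OF that]])
       (intro continuous_map_diff g_cont S_cont borel_measurable_diff g_meas S_meas that; assumption)+
  have R_meas: "R j \<in> borel_measurable M" for j
    unfolding R_def using g_norm_meas by (intro borel_measurable_prod_ennreal) auto
  have E_meas: "E k \<in> borel_measurable M" for k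
    unfolding E_def by (intro borel_measurable_sum borel_measurable_times_ennreal D_meas R_meas)
  have G_meas: "G \<in> borel_measurable M"
    unfolding G_def using g_norm_meas by (intro borel_measurable_prod_ennreal) auto
  have G_int: "(\<integral>\<^sup>+\<sigma>. G \<sigma> \<partial>M) < \<infinity>"
    using assms(7) by (simp add: G_def g_def)

  have f_G: "?N (f \<sigma>) \<le> G \<sigma>" if "\<sigma> \<in> space M" for \<sigma>
    unfolding f_def G_def by (rule varopoulos_norm_tensor[OF m g_cont[OF _ that]])
  have s_G: "?N (s k \<sigma>) \<le> G \<sigma>" for k \<sigma>
  proof -
    have "?N (s k \<sigma>) \<le> (\<Prod>i=1..m. sup_norm (X i) (S k i \<sigma>))"
      unfolding s_def by (rule varopoulos_norm_tensor[OF m S_cont])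
    also have "\<dots> \<le> G \<sigma>"
      unfolding G_def by (intro prod_mono_ennreal S_le)
    finally show ?thesis .
  qed
  have G_fin: "G \<sigma> < \<infinity>" if "\<sigma> \<in> space M" for \<sigma>
    unfolding G_def infinity_ennreal_def using g_fin[OF _ that] by (intro ennreal_prod_less_top) auto
  have f_V: "f \<sigma> \<in> varopoulos m X" if "\<sigma> \<in> space M" for \<sigma>
    unfolding varopoulos_iff using le_less_trans[OF f_G[OF that] G_fin[OF that]]
    by (simp add: f_def tensor_off_space)
  have s_V: "s k \<sigma> \<in> varopoulos m X" if "\<sigma> \<in> space M" for k \<sigma>
    unfolding varopoulos_iff using le_less_trans[OF s_G G_fin[OF that]]
    by (simp add: s_def tensor_off_space)

  have E: "?N (\<lambda>\<omega>. f \<sigma> \<omega> - s k \<sigma> \<omega>) \<le> E k \<sigma>" if "\<sigma> \<in> space M" for k \<sigma>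
    unfolding f_def s_def E_def D_def R_def
    by (rule varopoulos_norm_tensor_diff[OF m g_cont[OF _ that] S_cont S_le])
  have E_lim: "(\<lambda>k. E k \<sigma>) \<longlonglongrightarrow> 0" if "\<sigma> \<in> space M" for \<sigma>
  proof -
    have "(\<lambda>k. D k j \<sigma> * R j \<sigma>) \<longlonglongrightarrow> 0 * R j \<sigma>" if j: "j \<in> {1..m}" for j
    proof (rule tendsto_mult_ennreal)
      show "(\<lambda>k. D k j \<sigma>) \<longlonglongrightarrow> 0"
        unfolding D_def S_def
        by (rule sup_norm_net_interpolant_tendsto[OF net[OF j] cpt[OF j] g_cont[OF j \<open>\<sigma> \<in> space M\<close>]])
    qed (use R_fin[OF \<open>\<sigma> \<in> space M\<close>, of j] in auto)
    then have "(\<lambda>k. E k \<sigma>) \<longlonglongrightarrow> (\<Sum>j=1..m. 0)"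
      unfolding E_def by (intro tendsto_sum) auto
    then show ?thesis by simp
  qed
  have E_le: "E k \<sigma> \<le> of_nat (2 * m) * G \<sigma>" for k \<sigma>
  proof -
    have "E k \<sigma> \<le> (\<Sum>j=1..m. 2 * G \<sigma>)"
      unfolding E_def
    proof (rule sum_mono)
      fix j assume j: "j \<in> {1..m}"
      have "D k j \<sigma> \<le> sup_norm (X j) (g j \<sigma>) + sup_norm (X j) (S k j \<sigma>)"
        unfolding D_def by (rule sup_norm_diff)
      also have "\<dots> \<le> 2 * sup_norm (X j) (g j \<sigma>)"
        unfolding mult_2 by (intro add_left_mono S_le[OF j])
      finally show "D k j \<sigma> * R j \<sigma> \<le> 2 * G \<sigma>"
        unfolding G_split[OF j] by (simp add: mult_right_mono flip: mult.assoc)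
    qed
    then show ?thesis by (simp add: mult_ac)
  qed
  have E_int: "(\<lambda>k. \<integral>\<^sup>+\<sigma>. E k \<sigma> \<partial>M) \<longlonglongrightarrow> 0"
  proof -
    have "(\<lambda>k. \<integral>\<^sup>+\<sigma>. E k \<sigma> \<partial>M) \<longlonglongrightarrow> (\<integral>\<^sup>+\<sigma>. 0 \<partial>M)"
    proof (rule nn_integral_dominated_convergence[where w="\<lambda>\<sigma>. of_nat (2 * m) * G \<sigma>"])
      show "(\<integral>\<^sup>+\<sigma>. of_nat (2 * m) * G \<sigma> \<partial>M) < \<infinity>"
        using G_int by (simp add: nn_integral_cmult[OF G_meas] ennreal_mult_less_top ennreal_of_nat_eq_real_of_nat)
    qed (use E_meas G_meas E_le E_lim in auto)
    then show ?thesis by simp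
  qed

  have s_int: "Bochner_Integration.simple_bochner_integrable M (s k)" for k
  proof
    show s_simple: "simple_function M (s k)"
      unfolding s_def by (rule simple_function_tensor[OF S_simple])
    let ?c = "ennreal (real (Suc k) ^ m)"
    \<comment> \<open>Where the rounded tensor does not vanish, every factor has norm at least
      \<open>1 / Suc k\<close>, so Markov's inequality bounds the measure of its support.\<close>
    have "{\<sigma> \<in> space M. s k \<sigma> \<noteq> 0} \<subseteq> {\<sigma> \<in> space M. 1 \<le> ?c * G \<sigma>}"
    proof safe
      fix \<sigma> assume \<sigma>: "\<sigma> \<in> space M" and nz: "s k \<sigma> \<noteq> 0"
      from nz obtain \<omega> where "s k \<sigma> \<omega> \<noteq> 0"
        by (auto simp: fun_eq_iff)
      then have nz': "S k i \<sigma> (\<omega> i) \<noteq> 0" if "i \<in> {1..m}" for i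
        using that by (auto simp: s_def tensor_def on_space_def split: if_splits)
      have "ennreal (1 / real (Suc k)) ^ m = (\<Prod>i=1..m. ennreal (1 / real (Suc k)))"
        by simp
      also have "\<dots> \<le> G \<sigma>"
        unfolding G_def
        using nz' unfolding S_def by (intro prod_mono_ennreal net_interpolant_nonzero[OF net]) auto
      finally have "?c * ennreal (1 / real (Suc k)) ^ m \<le> ?c * G \<sigma>"
        by (rule mult_left_mono) simp
      moreover have "?c * ennreal (1 / real (Suc k)) ^ m = 1"
        by (simp add: ennreal_power ennreal_mult[symmetric] power_one_over)
      ultimately show "1 \<le> ?c * G \<sigma>" by simp
    qed
    then have "emeasure M {\<sigma> \<in> space M. s k \<sigma> \<noteq> 0} \<le> emeasure M {\<sigma> \<in> space M. 1 \<le> ?c * G \<sigma>}"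
      by (rule emeasure_mono) (use G_meas in measurable)
    also have "\<dots> \<le> ?c * (\<integral>\<^sup>+\<sigma>. G \<sigma> * indicator (space M) \<sigma> \<partial>M)"
      by (rule nn_integral_Markov_inequality) (use G_meas in auto)
    also have "\<dots> < \<infinity>"
      using G_int by (simp add: ennreal_mult_less_top nn_integral_set_ennreal[symmetric] cong: nn_integral_cong)
    finally show "emeasure M {\<sigma> \<in> space M. s k \<sigma> \<noteq> 0} \<noteq> \<infinity>" by simp
  qed

  have f_meas: "(\<lambda>\<sigma>. f \<sigma> \<omega>) \<in> borel_measurable M" if "\<omega> \<in> topspace (prod_space m X)" for \<omega>
    unfolding f_def tensor_apply[OF that]
    by (intro borel_measurable_prod g_meas prod_space_coordinate[OF that])
  have \<Phi>': "\<Phi> = on_space (prod_space m X) (\<lambda>\<omega>. LINT \<sigma>|M. f \<sigma> \<omega>)"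
    unfolding \<Phi> by (rule ext) (simp add: on_space_def f_def g_def tensor_def del: topspace_product_topology)
  note * = varopoulos_bochner_integral[where f=f and s=s and E=E and G=G,
      OF m f_V f_meas s_int s_V E_meas E E_lim E_int f_G s_G G_int \<Phi>']
  show ?thesis
    using * by (simp add: f_def[abs_def] g_def[abs_def] G_def[abs_def] has_bochner_integral_in_def)
qed

end
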